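(* Let $\mu\in\mathbb{C}$ with $\operatorname{Re}\mu<1/2$. Let $\psi$ be a $2\pi$-periodic complex-valued function with $\psi\in C^1[-\pi,\pi]$, put $\varphi(u)=\psi(u)\sinh u$, and let $$f(t)=(t^2-1)^{-\mu/2}\int_{-\pi}^{\pi}\frac{\varphi(u)\,du}{(t+\cosh u)^{3/2-\mu}},\qquad t>1.$$ Then for all $x>1$, $$f(x)=\frac1\pi\sum_{n=1}^\infty n\sinh(\pi n)\,\Gamma\!\left(\tfrac12+in-\mu\right)\Gamma\!\left(\tfrac12-in-\mu\right)P^\mu_{in-1/2}(x,\pi)\int_1^\infty P^\mu_{in-1/2}(t)f(t)\,dt.$$
   Context: $\Gamma$ is Euler's gamma function and $i$ the imaginary unit; powers of positive numbers are principal values. For $x>1$, $P^\mu_\nu(x)$ is the associated Legendre function (of the first kind), i.e. the analytic continuation to $x>1$ of $P^\mu_\nu(z)=\frac{1}{\Gamma(1-\mu)}\left(\frac{z+1}{z-1}\right)^{\mu/2}{}_2F_1\!\left(-\nu,1+\nu;1-\mu;\frac{1-z}{2}\right)$ ($|1-z|<2$), ${}_2F_1$ the Gauss hypergeometric function. The incomplete Legendre integral is defined for $z>1$, $\omega>0$ by $$P^\mu_\nu(z,\omega)=\sqrt{\tfrac{2}{\pi}}\,\frac{\Gamma(1/2-\mu)(z^2-1)^{-\mu/2}}{\Gamma(1+\nu-\mu)\Gamma(-\nu-\mu)}\int_0^\omega\frac{\cosh(t(\nu+1/2))}{(\cosh t+z)^{1/2-\mu}}\,dt;$$ here $\nu=in-1/2$,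 $\omega=\pi$. *)

theory Defs
  imports "HOL-Analysis.Analysis"
begin

text \<open>Regularized Gauss hypergeometric series  2F1(a,b;c;z)/Gamma(c)
  (its power series, convergent for norm z < 1).\<close>
definition hyp2F1_reg :: "complex \<Rightarrow> complex \<Rightarrow> complex \<Rightarrow> complex \<Rightarrow> complex" where
  "hyp2F1_reg a b c z =
     (\<Sum>k. pochhammer a k * pochhammer b k * rGamma (c + of_nat k) / fact k * z ^ k)"

definition legendreP_local :: "complex \<Rightarrow> complex \<Rightarrow> real \<Rightarrow> complex" where
  "legendreP_local mu nu t =
     complex_of_real ((t + 1) / (t - 1)) powr (mu / 2) *
     hyp2F1_reg (- nu) (1 + nu) (1 - mu) (complex_of_real ((1 - t) / 2))"

text \<open>Associated Legendre function of the first kind for real x > 1: value at x of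
  the analytic continuation (along a connected open neighbourhood of the ray (1,oo))
  of the local formula valid on (1,3).\<close>
definition legendreP :: "complex \<Rightarrow> complex \<Rightarrow> real \<Rightarrow> complex" where
  "legendreP mu nu x =
     (SOME c. \<exists>U h. open U \<and> connected U \<and> complex_of_real ` {1<..} \<subseteq> U \<and>
        h holomorphic_on U \<and>
        (\<forall>t\<in>{1<..<3}. h (complex_of_real t) = legendreP_local mu nu t) \<and>
        h (complex_of_real x) = c)"

definition legendreP_inc :: "complex \<Rightarrow> complex \<Rightarrow> real \<Rightarrow> real \<Rightarrow> complex" where
  "legendreP_inc mu nu z \<omega> =
     complex_of_real (sqrt (2 / pi)) * Gamma (1/2 - mu) *
     complex_of_real (z^2 - 1) powr (- mu / 2) /
     (Gamma (1 + nu - mu) * Gamma (- nu - mu)) *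
     integral {0..\<omega>} (\<lambda>t. cosh (complex_of_real t * (nu + 1/2)) /
                           complex_of_real (cosh t + z) powr (1/2 - mu))"

end

theory Submission
  imports Defs "HOL-Complex_Analysis.Complex_Analysis"
begin

text \<open>
  Write A(u) for psi(u) - psi(-u), and let nu = in - 1/2. By the Mehler-Dirichlet formula,
  (t^2-1)^(-mu/2) P^mu_nu(t) is a constant times the integral of
  cos(ns) (t - cosh s)^(-mu-1/2) over 0 < s < arcosh t. Inserting this and the definition of f into
  the integral of P^mu_nu f and integrating over t first, the t-integral is elementary and equals
  1/((1/2-mu)(cosh s + cosh u)). The s-integral is then a Fourier transform, which follows from
  the Beta integral: sinh u times the integral of cos(ns)/(cosh s + cosh u) over s > 0 is
  pi sin(n u)/sinh(pi n). Hence the transform of f is, up to explicit factors, the n-th Fourier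
  sine coefficient of A. Integrating by parts turns it into a cosine coefficient of A', the
  incomplete Legendre integral is a cosine coefficient of (x + cosh t)^(mu-1/2), and the series
  becomes Parseval's identity for cosine series on [0, pi]; the coefficient of A' for n = 0
  vanishes because psi is periodic.
\<close>

section \<open>Holomorphic parameter integrals\<close>

text \<open>The obstacle is that \<open>legendreP\<close> is a choice among analytic continuations,
  while its series is available only on (1, 3). The Mehler-Dirichlet integral is therefore rescaled
  to a fixed interval, with a kernel holomorphic on Re z > 1; it is matched with the series on (1,
  3) by termwise integration against Beta weights, and the identity theorem carries the match to the
  whole ray. The variable y = cosh s - 1 serves this purpose, since cos(ns)/cosh(s/2) is a power
  series in y/2 = sinh(s/2)^2. The condition Re mu < 1/2 makes (t - 1 - y)^(-mu - 1/2) integrable at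
  its singularity, so the exchange of integrals is absolutely convergent.

  Of A' only continuity is known, and the Fourier series of a continuous function may diverge at a
  point. Pairing two continuous functions by Parseval avoids any pointwise convergence.\<close>

lemma holomorphic_on_lebesgue_integral:
  fixes f :: "complex \<Rightarrow> 'a \<Rightarrow> complex" and w :: "'a \<Rightarrow> real"
  assumes U: "open U"
    and hol: "\<And>r. r \<in> space M \<Longrightarrow> (\<lambda>z. f z r) holomorphic_on U"
    and meas: "\<And>z. z \<in> U \<Longrightarrow> f z \<in> borel_measurable M"
    and w: "integrable M w"
    and bound: "\<And>z r. z \<in> U \<Longrightarrow> r \<in> space M \<Longrightarrow> norm (f z r) \<le> w r"
  shows "(\<lambda>z. \<integral>r. f z r \<partial>M) holomorphic_on U"
proof -
  have int: "integrable M (f z)" if "z \<in> U" for z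
  proof (rule Bochner_Integration.integrable_bound[OF w meas[OF that]], rule AE_I2)
    fix r assume "r \<in> space M"
    then have "norm (f z r) \<le> w r" by (rule bound[OF that])
    then show "norm (f z r) \<le> norm (w r)" by simp
  qed
  have "(\<lambda>z. \<integral>r. f z r \<partial>M) field_differentiable at z" if z: "z \<in> U" for z
  proof -
    obtain e where e: "e > 0" "cball z e \<subseteq> U"
      using U z by (auto simp: open_contains_cball)
    \<comment> \<open>Cauchy's estimate on the disc of radius e/2 about y, which stays inside
      \<open>cball z e\<close>. It turns the bound \<open>w\<close> on the values into an integrable
      bound on derivatives, hence on difference quotients by the mean value inequality.\<close>
    have dbound: "norm (deriv (\<lambda>z. f z r) y) \<le> w r / (e/2)"
      if r: "r \<in> space M" and y: "y \<in> ball z (e/2)" for y r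
    proof -
      have sub: "cball y (e/2) \<subseteq> U"
      proof
        fix x assume "x \<in> cball y (e/2)"
        then have "dist z x \<le> e"
          using y dist_triangle[of z x y] by (simp add: dist_commute)
        then show "x \<in> U" using e by auto
      qed
      have h: "(\<lambda>z. f z r) holomorphic_on cball y (e/2)"
        by (rule holomorphic_on_subset[OF hol[OF r] sub])
      have "norm ((deriv ^^ 1) (\<lambda>z. f z r) y) \<le> fact 1 * w r / (e/2) ^ 1"
      proof (rule Cauchy_inequality)
        show "(\<lambda>z. f z r) holomorphic_on ball y (e/2)"
          using h ball_subset_cball holomorphic_on_subset by blast
        show "continuous_on (cball y (e/2)) (\<lambda>z. f z r)"
          by (rule holomorphic_on_imp_continuous_on[OF h])
        show "0 < e/2" using e by simp
        fix x assume "norm (y - x) = e/2"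
        then have "x \<in> U" using sub by (auto simp: dist_norm)
        then show "norm (f x r) \<le> w r" using bound r by blast
      qed
      then show ?thesis by simp
    qed
    have quot: "norm ((f (z + h) r - f z r) / h) \<le> w r / (e/2)"
      if r: "r \<in> space M" and h: "norm h < e/2" "h \<noteq> 0" for h r
    proof -
      have "norm (f (z + h) r - f z r) \<le> w r / (e/2) * norm (z + h - z)"
      proof (rule field_differentiable_bound[where S="ball z (e/2)" and f'="deriv (\<lambda>z. f z r)"])
        fix y assume y: "y \<in> ball z (e/2)"
        then have "y \<in> U" using e by auto
        then show "((\<lambda>z. f z r) has_field_derivative deriv (\<lambda>z. f z r) y) (at y within ball z (e/2))"
          using holomorphic_derivI[OF hol[OF r] U] by blast
        show "norm (deriv (\<lambda>z. f z r) y) \<le> w r / (e/2)" by (rule dbound[OF r y])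
      qed (use h e(1) in \<open>simp_all add: dist_norm\<close>)
      then show ?thesis using h by (simp add: norm_divide divide_le_eq)
    qed
    have U': "z + h \<in> U" if "norm h < e/2" for h
    proof -
      have "z + h \<in> cball z e" using that e(1) by (simp add: dist_norm)
      then show ?thesis using e(2) by blast
    qed
    \<comment> \<open>One concrete null sequence with z + X n in U; it exhibits the derivative as a
      limit of measurable quotients, so that the derivative is measurable in r.\<close>
    define X where "X = (\<lambda>n::nat. complex_of_real (e / 4 / real (Suc n)))"
    have X: "X \<longlonglongrightarrow> 0" "\<And>n. X n \<noteq> 0" "\<And>n. norm (X n) < e/2"
    proof -
      have "(\<lambda>n::nat. complex_of_real (e / 4 / real (Suc n))) \<longlonglongrightarrow> of_real 0"
        by (intro tendsto_of_real LIMSEQ_Suc[OF lim_const_over_n, unfolded comp_def])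
      then show "X \<longlonglongrightarrow> 0" by (simp add: X_def)
      fix n
      show "X n \<noteq> 0" using e by (simp add: X_def del: of_nat_Suc)
      have "norm (X n) = e / 4 / real (Suc n)"
        using e by (simp add: X_def norm_divide del: of_nat_Suc)
      also have "\<dots> \<le> e / 4" using e by (simp add: field_simps)
      also have "\<dots> < e/2" using e by simp
      finally show "norm (X n) < e/2" .
    qed
    have lim: "(\<lambda>n. (f (z + Y n) r - f z r) / Y n) \<longlonglongrightarrow> deriv (\<lambda>z. f z r) z"
      if r: "r \<in> space M" and Y: "Y \<longlonglongrightarrow> 0" "\<And>n. Y n \<noteq> 0" for Y :: "nat \<Rightarrow> complex" and r
    proof -
      have "((\<lambda>z. f z r) has_field_derivative deriv (\<lambda>z. f z r) z) (at z)"
        using holomorphic_derivI[OF hol[OF r] U z] .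
      then have "((\<lambda>h. (f (z + h) r - f z r) / h) \<longlongrightarrow> deriv (\<lambda>z. f z r) z) (at 0)"
        by (simp add: DERIV_def)
      then show ?thesis
        using Y by (auto simp: tendsto_at_iff_sequentially comp_def)
    qed
    have dmeas: "(\<lambda>r. deriv (\<lambda>z. f z r) z) \<in> borel_measurable M"
    proof (rule borel_measurable_LIMSEQ_metric)
      show "(\<lambda>n. (f (z + X n) r - f z r) / X n) \<longlonglongrightarrow> deriv (\<lambda>z. f z r) z" if "r \<in> space M" for r
        by (rule lim[OF that X(1,2)])
      show "(\<lambda>r. (f (z + X n) r - f z r) / X n) \<in> borel_measurable M" for n
        using meas[OF U'[OF X(3)]] meas[OF z] by simp
    qed
    have "((\<lambda>z. \<integral>r. f z r \<partial>M) has_field_derivative (\<integral>r. deriv (\<lambda>z. f z r) z \<partial>M)) (at z)"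
      unfolding DERIV_def tendsto_at_iff_sequentially comp_def
    proof (intro allI impI)
      fix Y :: "nat \<Rightarrow> complex"
      assume Y0: "\<forall>i. Y i \<in> UNIV - {0}" and Y: "Y \<longlonglongrightarrow> 0"
      have "eventually (\<lambda>n. norm (Y n) < e/2) sequentially"
        using tendstoD[OF Y, of "e/2"] e by (simp add: dist_norm)
      then obtain N where N: "\<And>n. n \<ge> N \<Longrightarrow> norm (Y n) < e/2"
        by (auto simp: eventually_sequentially)
      \<comment> \<open>Dropping finitely many terms keeps z + Z n within the disc where
        \<open>quot\<close> dominates; the limit does not change.\<close>
      define Z where "Z = (\<lambda>n. Y (n + N))"
      have Z: "Z \<longlonglongrightarrow> 0" "\<And>n. Z n \<noteq> 0" "\<And>n. norm (Z n) < e/2"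
        using LIMSEQ_ignore_initial_segment[OF Y] Y0 N by (auto simp: Z_def)
      have "(\<lambda>n. \<integral>r. (f (z + Z n) r - f z r) / Z n \<partial>M) \<longlonglongrightarrow> (\<integral>r. deriv (\<lambda>z. f z r) z \<partial>M)"
      proof (rule integral_dominated_convergence)
        show "(\<lambda>r. (f (z + Z n) r - f z r) / Z n) \<in> borel_measurable M" for n
          using meas[OF U'[OF Z(3)]] meas[OF z] by simp
        show "AE r in M. (\<lambda>n. (f (z + Z n) r - f z r) / Z n) \<longlonglongrightarrow> deriv (\<lambda>z. f z r) z"
          by (intro AE_I2 lim Z)
        show "AE r in M. norm ((f (z + Z n) r - f z r) / Z n) \<le> w r / (e/2)" for n
          by (intro AE_I2 quot Z)
      qed (use w dmeas in auto)
      also have "(\<lambda>n. \<integral>r. (f (z + Z n) r - f z r) / Z n \<partial>M) =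
          (\<lambda>n. ((\<integral>r. f (z + Z n) r \<partial>M) - (\<integral>r. f z r \<partial>M)) / Z n)"
        using int[OF U'[OF Z(3)]] int[OF z] by simp
      finally show "(\<lambda>n. ((\<integral>r. f (z + Y n) r \<partial>M) - (\<integral>r. f z r \<partial>M)) / Y n)
          \<longlonglongrightarrow> (\<integral>r. deriv (\<lambda>z. f z r) z \<partial>M)"
        unfolding Z_def by (rule LIMSEQ_offset)
    qed
    then show ?thesis by (auto simp: field_differentiable_def)
  qed
  then show ?thesis
    by (auto simp: holomorphic_on_def intro: field_differentiable_at_within)
qed

text \<open>For x > 0 this is the principal power; unlike powr it is visibly Borel measurable in x.\<close>

definition cpow :: "real \<Rightarrow> complex \<Rightarrow> complex" where
  "cpow x z = exp (z * of_real (ln x))"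

lemma cpow_measurable [measurable (raw)]:
  "f \<in> borel_measurable M \<Longrightarrow> (\<lambda>x. cpow (f x) z) \<in> borel_measurable M"
  unfolding cpow_def by simp

lemma cpow_eq_powr: "x > 0 \<Longrightarrow> of_real x powr z = cpow x z"
  by (simp add: cpow_def powr_def Ln_of_real)

lemma norm_cpow: "x > 0 \<Longrightarrow> norm (cpow x z) = x powr Re z"
  by (simp add: cpow_def powr_def)

lemma cpow_of_real: "x > 0 \<Longrightarrow> cpow x (of_real a) = of_real (x powr a)"
  by (simp add: cpow_def powr_def exp_of_real flip: of_real_mult)

lemma cpow_add: "cpow x (a + b) = cpow x a * cpow x b"
  by (simp add: cpow_def distrib_right exp_add)

lemma cpow_minus: "cpow x (- a) = inverse (cpow x a)"
  by (simp add: cpow_def exp_minus)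

lemma cpow_mult: "x > 0 \<Longrightarrow> y > 0 \<Longrightarrow> cpow (x * y) a = cpow x a * cpow y a"
  by (simp add: cpow_def ln_mult distrib_left exp_add)

lemma cpow_divide: "x > 0 \<Longrightarrow> y > 0 \<Longrightarrow> cpow (x / y) a = cpow x a / cpow y a"
  by (simp add: cpow_def ln_div right_diff_distrib exp_diff)

lemma cpow_nonzero [simp]: "cpow x a \<noteq> 0"
  by (simp add: cpow_def)

lemma cpow_nat: "x > 0 \<Longrightarrow> cpow x (of_nat k) = of_real x ^ k"
  using cpow_of_real[of x "real k"] by (simp add: powr_realpow)

lemma integrable_Beta_weight:
  fixes a b :: real
  assumes "a > 0" "b > 0"
  shows "integrable lborel (\<lambda>r. indicator {0<..<1} r * (r powr (a-1) * (1-r) powr (b-1)))"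
    and "(\<integral>r. indicator {0<..<1} r * (r powr (a-1) * (1-r) powr (b-1)) \<partial>lborel) = Beta a b"
proof -
  let ?f = "\<lambda>r::real. r powr (a-1) * (1-r) powr (b-1)"
  have i: "set_integrable lborel {0<..<1} ?f"
    by (rule set_integrable_subset[OF integrable_Beta[OF assms]]) auto
  then show "integrable lborel (\<lambda>r. indicator {0<..<1} r * ?f r)"
    by (simp add: set_integrable_def)
  have "(?f has_integral Beta a b) {0<..<1}"
    using has_integral_Beta_real[OF assms] by (simp add: has_integral_Icc_iff_Ioo)
  then have "(LINT x : {0<..<1} | lborel. ?f x) = Beta a b"
    using set_borel_integral_eq_integral(2)[OF i] by (simp add: integral_unique)
  then show "(\<integral>r. indicator {0<..<1} r * ?f r \<partial>lborel) = Beta a b"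
    by (simp add: set_lebesgue_integral_def)
qed

section \<open>The Beta integral with complex parameters\<close>

definition Beta_int :: "complex \<Rightarrow> complex \<Rightarrow> complex" where
  "Beta_int a b = (\<integral>r. indicator {0<..<1} r *\<^sub>R (cpow r (a-1) * cpow (1-r) (b-1)) \<partial>lborel)"

lemma norm_Beta_integrand:
  "norm (indicator {0<..<1} r *\<^sub>R (cpow r (a-1) * cpow (1-r) (b-1))) =
    indicator {0<..<1} r * (r powr (Re a - 1) * (1-r) powr (Re b - 1))"
  by (auto simp: indicator_def norm_mult norm_cpow)

lemma integrable_Beta_complex:
  assumes "Re a > 0" "Re b > 0"
  shows "integrable lborel (\<lambda>r. indicator {0<..<1} r *\<^sub>R (cpow r (a-1) * cpow (1-r) (b-1)))"
proof (rule Bochner_Integration.integrable_bound[OF integrable_Beta_weight(1)[OF assms]])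
  show "(\<lambda>r. indicator {0<..<1} r *\<^sub>R (cpow r (a-1) * cpow (1-r) (b-1))) \<in> borel_measurable lborel"
    by measurable
qed (simp only: norm_Beta_integrand real_norm_def abs_ge_self, simp)

lemma Beta_int_commute: "Beta_int a b = Beta_int b a"
proof -
  have "Beta_int a b = (\<integral>r. indicator {0<..<1} (1 + (-1) * r) *\<^sub>R
      (cpow (1 + (-1) * r) (a-1) * cpow (1-(1 + (-1) * r)) (b-1)) \<partial>lborel)"
    unfolding Beta_int_def by (subst lborel_integral_real_affine[where c="-1" and t=1]) auto
  also have "\<dots> = Beta_int b a"
    unfolding Beta_int_def by (intro Bochner_Integration.integral_cong) (auto simp: indicator_def)
  finally show ?thesis .
qed

text \<open>Supplies the accumulation point that the identity theorem needs when two holomorphic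
  functions are known to agree on a real interval or ray.\<close>

lemma islimpt_of_real_open:
  assumes "open S" "x \<in> S"
  shows "complex_of_real x islimpt of_real ` S"
  unfolding islimpt_sequential
proof -
  obtain X where X: "\<And>n::nat. X n \<in> S - {x}" "X \<longlonglongrightarrow> x"
    using interior_limit_point[of x S] assms by (auto simp: islimpt_sequential interior_open)
  show "\<exists>f. (\<forall>n::nat. f n \<in> of_real ` S - {complex_of_real x}) \<and> f \<longlonglongrightarrow> complex_of_real x"
    by (rule exI[of _ "\<lambda>n. of_real (X n)"]) (use X in \<open>auto intro!: tendsto_of_real\<close>)
qed

text \<open>Identity theorem in the first argument: both sides are holomorphic on Re z > e and agree
  on the real points there. Cutting at e = Re a / 2 instead of 0 lets the single weight with
  exponent e - 1 dominate the integrand throughout the half-plane.\<close>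

lemma Beta_int_extend:
  assumes b: "Re b > 0" and a: "Re a > 0"
    and eq: "\<And>x. x > 0 \<Longrightarrow> Beta_int (of_real x) b = Beta (of_real x) b"
  shows "Beta_int a b = Beta a b"
proof -
  define e where "e = Re a / 2"
  have e: "e > 0" "e < Re a" using a by (auto simp: e_def)
  define U where "U = {z. Re z > e}"
  have U: "open U" "connected U"
    by (auto simp: U_def open_halfspace_Re_gt intro!: convex_connected convex_halfspace_Re_gt)
  have h1: "(\<lambda>a. Beta_int a b) holomorphic_on U"
    unfolding Beta_int_def
  proof (rule holomorphic_on_lebesgue_integral[OF U(1)])
    show "integrable lborel (\<lambda>r. indicator {0<..<1} r * (r powr (e - 1) * (1-r) powr (Re b - 1)))"
      by (rule integrable_Beta_weight(1)) (use e b in auto)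
    show "norm (indicator {0<..<1} r *\<^sub>R (cpow r (z-1) * cpow (1-r) (b-1)))
       \<le> indicator {0<..<1} r * (r powr (e - 1) * (1-r) powr (Re b - 1))" if "z \<in> U" for z r
      unfolding norm_Beta_integrand using that
      by (auto simp: indicator_def U_def intro!: mult_right_mono powr_mono')
  qed (auto simp: cpow_def intro!: holomorphic_intros)
  have nonpos: "z \<notin> \<int>\<^sub>\<le>\<^sub>0" if "Re z > 0" for z
    using that by (auto elim!: nonpos_Ints_cases)
  have h2: "(\<lambda>a. Beta a b) holomorphic_on U"
    by (intro holomorphic_intros nonpos) (use b e in \<open>auto simp: U_def\<close>)
  have "Beta_int a b - Beta a b = 0"
  proof (rule analytic_continuation[where f="\<lambda>a. Beta_int a b - Beta a b" and w=a and S=U and U="of_real ` {e<..}" and \<xi>="of_real (e+1)"])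
    show "(\<lambda>a. Beta_int a b - Beta a b) holomorphic_on U"
      by (intro holomorphic_intros h1 h2)
    show "complex_of_real (e+1) islimpt of_real ` {e<..}"
      by (rule islimpt_of_real_open) auto
  qed (use U e eq in \<open>auto simp: U_def\<close>)
  then show ?thesis by simp
qed

text \<open>The extension is applied once in each argument: the real case makes the first argument
  complex, symmetry swaps the roles, and a second extension frees the argument that was still
  real.\<close>

lemma Beta_integral_complex:
  assumes a: "Re a > 0" and b: "Re b > 0"
  shows "(\<integral>r. indicator {0<..<1} r *\<^sub>R (cpow r (a-1) * cpow (1-r) (b-1)) \<partial>lborel) = Beta a b"
proof -
  have rr: "Beta_int (of_real x) (of_real y) = Beta (of_real x) (of_real y)" if "x > 0" "y > 0" for x y
  proof -
    have "Beta_int (of_real x) (of_real y) =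
        (\<integral>r. complex_of_real (indicator {0<..<1} r * (r powr (x-1) * (1-r) powr (y-1))) \<partial>lborel)"
      unfolding Beta_int_def
    proof (intro Bochner_Integration.integral_cong refl)
      fix r :: real
      have "cpow r (of_real x - 1) = of_real (r powr (x-1))" if "r > 0"
        using cpow_of_real[OF that, of "x-1"] by simp
      moreover have "cpow (1-r) (of_real y - 1) = of_real ((1-r) powr (y-1))" if "r < 1"
        using cpow_of_real[of "1-r" "y-1"] that by simp
      ultimately show "indicator {0<..<1} r *\<^sub>R (cpow r (of_real x-1) * cpow (1-r) (of_real y-1)) =
        complex_of_real (indicator {0<..<1} r * (r powr (x-1) * (1-r) powr (y-1)))"
        by (auto simp: indicator_def)
    qed
    also have "\<dots> = of_real (Beta x y)"
      by (simp only: integral_complex_of_real integrable_Beta_weight(2)[OF that])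
    finally show ?thesis by (simp add: Beta_complex_of_real)
  qed
  have "Beta_int a (of_real y) = Beta a (of_real y)" if "y > 0" for y
    by (rule Beta_int_extend) (use a that rr in auto)
  then have ya: "Beta_int (of_real y) a = Beta (of_real y) a" if "y > 0" for y
    using that by (simp only: Beta_int_commute[of _ a] Beta_commute[of _ a])
  have "Beta_int b a = Beta b a"
    by (rule Beta_int_extend[OF a b ya])
  then have "Beta_int a b = Beta a b" by (simp only: Beta_int_commute[of a] Beta_commute[of a])
  then show ?thesis unfolding Beta_int_def .
qed

section \<open>The generating kernel of the conical functions\<close>

text \<open>The coefficients of 2F1(1/2-in, 1/2+in; 1/2; -v) as a power series in v; with v = sinh(s/2)^2 the sum is
  cos(ns)/cosh(s/2).\<close>

definition conical_coeff :: "real \<Rightarrow> nat \<Rightarrow> real" where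
  "conical_coeff n k = (\<Prod>j<k. - ((real j + 1/2)\<^sup>2 + n\<^sup>2) / ((real j + 1/2) * (real j + 1)))"

lemma conical_coeff_0 [simp]: "conical_coeff n 0 = 1"
  by (simp add: conical_coeff_def)

lemma conical_coeff_Suc:
  "(real k + 1) * (real k + 1/2) * conical_coeff n (Suc k) =
     - ((real k + 1/2)\<^sup>2 + n\<^sup>2) * conical_coeff n k"
proof -
  have "conical_coeff n (Suc k) =
      conical_coeff n k * (- ((real k + 1/2)\<^sup>2 + n\<^sup>2) / ((real k + 1/2) * (real k + 1)))"
    by (simp add: conical_coeff_def)
  moreover have "(real k + 1) * (real k + 1/2) \<noteq> 0" by (simp add: add_eq_0_iff)
  ultimately show ?thesis by (simp add: field_simps)
qed

text \<open>Ratio test. Once k >= 2 n^2, one has (k + 1/2)^2 + n^2 <= (k + 1)(k + 1/2), so the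
  coefficients no longer grow in absolute value.\<close>

lemma summable_conical_coeff:
  assumes "\<bar>K\<bar> < 1"
  shows "summable (\<lambda>k. conical_coeff n k * K ^ k)"
proof (rule summable_ratio_test[of "\<bar>K\<bar>" "nat \<lceil>2 * n\<^sup>2\<rceil>"])
  fix k assume "k \<ge> nat \<lceil>2 * n\<^sup>2\<rceil>"
  then have k: "2 * n\<^sup>2 \<le> real k" by linarith
  let ?A = "(real k + 1/2)\<^sup>2 + n\<^sup>2" and ?B = "(real k + 1) * (real k + 1/2)"
  have pos: "?B > 0" by (intro mult_pos_pos) auto
  have AB: "0 \<le> ?A" "?A \<le> ?B" using k by (auto simp: power2_eq_square algebra_simps)
  have "?B * \<bar>conical_coeff n (Suc k)\<bar> = \<bar>?B * conical_coeff n (Suc k)\<bar>"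
    using pos by (simp add: abs_mult)
  also have "\<dots> = ?A * \<bar>conical_coeff n k\<bar>"
    unfolding conical_coeff_Suc using AB by (simp add: abs_mult abs_minus_commute)
  also have "\<dots> \<le> ?B * \<bar>conical_coeff n k\<bar>"
    by (intro mult_right_mono AB) auto
  finally have "\<bar>conical_coeff n (Suc k)\<bar> \<le> \<bar>conical_coeff n k\<bar>"
    using pos by (simp only: mult_le_cancel_left_pos)
  then have "\<bar>conical_coeff n (Suc k)\<bar> * \<bar>K\<bar> ^ Suc k \<le> \<bar>conical_coeff n k\<bar> * \<bar>K\<bar> ^ Suc k"
    by (intro mult_right_mono) auto
  then show "norm (conical_coeff n (Suc k) * K ^ Suc k) \<le> \<bar>K\<bar> * norm (conical_coeff n k * K ^ k)"
    by (simp add: abs_mult power_abs mult_ac)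
qed (use assms in auto)

definition conical_series :: "real \<Rightarrow> real \<Rightarrow> real" where
  "conical_series n v = (\<Sum>k. conical_coeff n k * v ^ k)"

text \<open>The third claim is the hypergeometric equation with parameters 1/2 - in, 1/2 + in, 1/2
  after z = -v. Compared power by power, it is exactly the recurrence
  \<open>conical_coeff_Suc\<close>.\<close>

lemma conical_series_ode:
  defines "p1 \<equiv> \<lambda>n v. \<Sum>k. diffs (conical_coeff n) k * v ^ k"
    and "p2 \<equiv> \<lambda>n v. \<Sum>k. diffs (diffs (conical_coeff n)) k * v ^ k"
  assumes v: "\<bar>v::real\<bar> < 1"
  shows "(conical_series n has_real_derivative p1 n v) (at v)"
    and "(p1 n has_real_derivative p2 n v) (at v)"
    and "v * (1 + v) * p2 n v + (1/2 + 2 * v) * p1 n v + (1/4 + n\<^sup>2) * conical_series n v = 0"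
proof -
  let ?c = "conical_coeff n"
  let ?p1 = "\<lambda>v. \<Sum>k. diffs ?c k * v ^ k"
  let ?p2 = "\<lambda>v. \<Sum>k. diffs (diffs ?c) k * v ^ k"
  have ex: "\<exists>K. \<bar>x\<bar> < \<bar>K\<bar> \<and> \<bar>K\<bar> < 1" if "\<bar>x\<bar> < 1" for x :: real
    using that by (intro exI[of _ "(\<bar>x\<bar> + 1) / 2"]) simp
  have s0: "summable (\<lambda>k. ?c k * x ^ k)" if "\<bar>x\<bar> < 1" for x
    by (rule summable_conical_coeff[OF that])
  have s1: "summable (\<lambda>k. diffs ?c k * x ^ k)" if "\<bar>x\<bar> < 1" for x
  proof -
    obtain K where K: "\<bar>x\<bar> < \<bar>K\<bar>" "\<bar>K\<bar> < 1" using ex[OF \<open>\<bar>x\<bar> < 1\<close>] by blast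
    show ?thesis by (rule termdiff_converges[where K="\<bar>K\<bar>"]) (use K s0 in auto)
  qed
  have s2: "summable (\<lambda>k. diffs (diffs ?c) k * x ^ k)" if "\<bar>x\<bar> < 1" for x
  proof -
    obtain K where K: "\<bar>x\<bar> < \<bar>K\<bar>" "\<bar>K\<bar> < 1" using ex[OF \<open>\<bar>x\<bar> < 1\<close>] by blast
    show ?thesis by (rule termdiff_converges[where K="\<bar>K\<bar>"]) (use K s1 in auto)
  qed
  obtain K where K: "\<bar>v\<bar> < \<bar>K\<bar>" "\<bar>K\<bar> < 1" using ex[OF v] by blast
  show "(conical_series n has_real_derivative p1 n v) (at v)"
    unfolding p1_def conical_series_def[abs_def] by (rule termdiffs_strong[where K=K]) (use K s0 in auto)
  show "(p1 n has_real_derivative p2 n v) (at v)"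
    unfolding p1_def p2_def by (rule termdiffs_strong[where K=K]) (use K s1 in auto)
  have S0: "(\<lambda>k. ?c k * v ^ k) sums conical_series n v"
    unfolding conical_series_def using s0[OF v] by (rule summable_sums)
  have S1: "(\<lambda>k. diffs ?c k * v ^ k) sums ?p1 v" using s1[OF v] by (rule summable_sums)
  have S2: "(\<lambda>k. diffs (diffs ?c) k * v ^ k) sums ?p2 v" using s2[OF v] by (rule summable_sums)
  \<comment> \<open>Multiplication by v raises every index by one, and f 0 = 0 fills the place that
    becomes free. This brings all terms of the equation to the common power v^k.\<close>
  have shift: "f sums (v * S)" if "g sums S" "f 0 = 0" "\<And>k. f (Suc k) = v * g k" for f g :: "nat \<Rightarrow> real" and S
  proof -
    have "(\<lambda>k. f (Suc k)) sums (v * S)" unfolding that(3) by (rule sums_mult[OF that(1)])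
    then show ?thesis using that(2) by (simp add: sums_Suc_iff)
  qed
  have S1v: "(\<lambda>k. real k * ?c k * v ^ k) sums (v * ?p1 v)"
    by (rule shift[OF S1]) (auto simp: diffs_def)
  have S2v: "(\<lambda>k. real k * (real k + 1) * ?c (Suc k) * v ^ k) sums (v * ?p2 v)"
    by (rule shift[OF S2]) (auto simp: diffs_def algebra_simps)
  have S2vv: "(\<lambda>k. real k * (real k - 1) * ?c k * v ^ k) sums (v * (v * ?p2 v))"
    by (rule shift[OF S2v]) (auto simp: algebra_simps)
  have "(\<lambda>k. real k * (real k + 1) * ?c (Suc k) * v ^ k + real k * (real k - 1) * ?c k * v ^ k
          + (1/2 * (diffs ?c k * v ^ k) + 2 * (real k * ?c k * v ^ k)) + (1/4 + n\<^sup>2) * (?c k * v ^ k)) sums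
       (v * ?p2 v + v * (v * ?p2 v) + (1/2 * ?p1 v + 2 * (v * ?p1 v)) + (1/4 + n\<^sup>2) * conical_series n v)"
    by (intro sums_add sums_mult S0 S1 S1v S2v S2vv)
  moreover have "real k * (real k + 1) * ?c (Suc k) * v ^ k + real k * (real k - 1) * ?c k * v ^ k
          + (1/2 * (diffs ?c k * v ^ k) + 2 * (real k * ?c k * v ^ k)) + (1/4 + n\<^sup>2) * (?c k * v ^ k) = 0" for k
  proof -
    have "real k * (real k + 1) * ?c (Suc k) * v ^ k + real k * (real k - 1) * ?c k * v ^ k
          + (1/2 * (diffs ?c k * v ^ k) + 2 * (real k * ?c k * v ^ k)) + (1/4 + n\<^sup>2) * (?c k * v ^ k)
       = ((real k + 1) * (real k + 1/2) * ?c (Suc k) + ((real k + 1/2)\<^sup>2 + n\<^sup>2) * ?c k) * v ^ k"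
      by (simp add: diffs_def field_simps power2_eq_square)
    then show ?thesis by (simp only: conical_coeff_Suc) (simp add: algebra_simps)
  qed
  ultimately have "(\<lambda>k. 0) sums (v * ?p2 v + v * (v * ?p2 v) + (1/2 * ?p1 v + 2 * (v * ?p1 v)) + (1/4 + n\<^sup>2) * conical_series n v)"
    by (simp only:)
  from sums_unique2[OF sums_0[OF refl] this] have "v * ?p2 v + v * (v * ?p2 v) + (1/2 * ?p1 v + 2 * (v * ?p1 v)) + (1/4 + n\<^sup>2) * conical_series n v = 0"
    by (simp only: eq_commute)
  then show "v * (1 + v) * p2 n v + (1/2 + 2 * v) * p1 n v + (1/4 + n\<^sup>2) * conical_series n v = 0"
    unfolding p1_def p2_def by (simp add: algebra_simps)
qed

text \<open>Both sides solve y'' = -n^2 y with the same initial values.\<close>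

lemma conical_series_sinh:
  assumes s: "s \<ge> 0" "sinh (s/2) < 1" and n: "n > 0"
  shows "cosh (s/2) * conical_series n ((sinh (s/2))\<^sup>2) = cos (n * s)"
proof -
  obtain p1 p2 where
    p1: "\<And>v. \<bar>v\<bar> < 1 \<Longrightarrow> (conical_series n has_real_derivative p1 v) (at v)" and
    p2: "\<And>v. \<bar>v\<bar> < 1 \<Longrightarrow> (p1 has_real_derivative p2 v) (at v)" and
    ode: "\<And>v. \<bar>v\<bar> < 1 \<Longrightarrow>
       v * (1 + v) * p2 v + (1/2 + 2 * v) * p1 v + (1/4 + n\<^sup>2) * conical_series n v = 0"
    using that[OF conical_series_ode[of _ n]] .
  define q where "q = (\<lambda>r::real. (sinh (r/2))\<^sup>2)"
  \<comment> \<open>The initial value problem is solved along the whole segment from 0 to s, so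
    every intermediate q r has to lie in the disc of convergence.\<close>
  have q: "\<bar>q r\<bar> < 1" if "r \<in> {0..s}" for r
  proof -
    have "0 \<le> sinh (r/2)" "sinh (r/2) \<le> sinh (s/2)" using that by auto
    then have "0 \<le> sinh (r/2)" "sinh (r/2) < 1" using s by linarith+
    then have "(sinh (r/2))\<^sup>2 < 1" by (simp only: power_less_one_iff) simp
    then show ?thesis by (simp add: q_def)
  qed
  have dq: "(q has_real_derivative sinh (r/2) * cosh (r/2)) (at r)" for r
    unfolding q_def by (auto intro!: derivative_eq_intros)
  have dp: "((\<lambda>r. conical_series n (q r)) has_real_derivative p1 (q r) * (sinh (r/2) * cosh (r/2))) (at r)"
    and dp1: "((\<lambda>r. p1 (q r)) has_real_derivative p2 (q r) * (sinh (r/2) * cosh (r/2))) (at r)"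
    if r: "r \<in> {0..s}" for r
    using DERIV_chain2[where g=q and x=r, OF p1[OF q[OF r]] dq] DERIV_chain2[where g=q and x=r, OF p2[OF q[OF r]] dq] .
  define F where "F = (\<lambda>r. cosh (r/2) * conical_series n (q r))"
  define F1 where "F1 = (\<lambda>r. sinh (r/2) / 2 * conical_series n (q r) + sinh (r/2) * (cosh (r/2))\<^sup>2 * p1 (q r))"
  have dF: "(F has_real_derivative F1 r) (at r)" if r: "r \<in> {0..s}" for r
    unfolding F_def F1_def
    by (rule derivative_eq_intros dp[OF r] refl | simp add: power2_eq_square)+
  have dF1: "(F1 has_real_derivative - n\<^sup>2 * F r) (at r)" if r: "r \<in> {0..s}" for r
  proof -
    let ?S = "sinh (r/2)" and ?C = "cosh (r/2)"
    have "(F1 has_real_derivative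
        (?C / 4 * conical_series n (q r) + ?S / 2 * (p1 (q r) * (?S * ?C))
        + ((?C / 2 * ?C\<^sup>2 + ?S * (?C * ?S)) * p1 (q r) + ?S * ?C\<^sup>2 * (p2 (q r) * (?S * ?C))))) (at r)"
      unfolding F1_def
      by (rule derivative_eq_intros dp[OF r] dp1[OF r] refl | simp)+ (simp add: mult_ac)
    \<comment> \<open>With S^2 = q and C^2 = 1 + q, the second derivative of F becomes C times the
      left side of the hypergeometric equation, short of its n^2 term; that missing term yields F''
      = -n^2 F.\<close>
    moreover have "?C / 4 * conical_series n (q r) + ?S / 2 * (p1 (q r) * (?S * ?C))
        + ((?C / 2 * ?C\<^sup>2 + ?S * (?C * ?S)) * p1 (q r) + ?S * ?C\<^sup>2 * (p2 (q r) * (?S * ?C))) =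
        ?C * (q r * (1 + q r) * p2 (q r) + (1/2 + 2 * q r) * p1 (q r) + 1/4 * conical_series n (q r))"
    proof -
      have C2: "?C\<^sup>2 = 1 + q r" by (simp add: cosh_square_eq q_def)
      have S2: "?S * ?S = q r" by (simp add: q_def power2_eq_square)
      have "?C / 4 * conical_series n (q r) + ?S / 2 * (p1 (q r) * (?S * ?C))
        + ((?C / 2 * ?C\<^sup>2 + ?S * (?C * ?S)) * p1 (q r) + ?S * ?C\<^sup>2 * (p2 (q r) * (?S * ?C))) =
        ?C * ((?S * ?S) * ?C\<^sup>2 * p2 (q r) + ((?S * ?S) * (3/2) + ?C\<^sup>2/2) * p1 (q r) + 1/4 * conical_series n (q r))"
        by (simp add: algebra_simps)
      also have "\<dots> = ?C * (q r * (1 + q r) * p2 (q r) + (1/2 + 2 * q r) * p1 (q r) + 1/4 * conical_series n (q r))"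
        unfolding C2 S2 by (simp add: field_simps)
      finally show ?thesis .
    qed
    moreover have "q r * (1 + q r) * p2 (q r) + (1/2 + 2 * q r) * p1 (q r) + 1/4 * conical_series n (q r)
       = - n\<^sup>2 * conical_series n (q r)"
      using ode[OF q[OF r]] by (simp add: algebra_simps)
    ultimately show ?thesis by (simp add: F_def mult_ac)
  qed
  \<comment> \<open>The vector (F, F1/n) rotated by the angle n r. As F1 is the derivative of F and
    F'' = -n^2 F, both components are constant, and at r = 0 they are 1 and 0. Rotating back
    recovers F = cos(n r).\<close>
  define X where "X = (\<lambda>r. F r * cos (n * r) - F1 r * sin (n * r) / n)"
  define Y where "Y = (\<lambda>r. F r * sin (n * r) + F1 r * cos (n * r) / n)"
  have dsin: "((\<lambda>r. sin (n * r)) has_real_derivative n * cos (n * r)) (at r)"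
    and dcos: "((\<lambda>r. cos (n * r)) has_real_derivative - n * sin (n * r)) (at r)" for r
    by (auto intro!: derivative_eq_intros)
  have dX: "(X has_real_derivative 0) (at r)" if r: "r \<in> {0..s}" for r
  proof -
    have "(X has_real_derivative (F1 r * cos (n * r) + - n * sin (n * r) * F r)
        - ((- n\<^sup>2 * F r) * sin (n * r) + n * cos (n * r) * F1 r) / n) (at r)"
      unfolding X_def by (intro DERIV_diff DERIV_cdivide DERIV_mult dF[OF r] dF1[OF r] dsin dcos)
    moreover have "(F1 r * cos (n * r) + - n * sin (n * r) * F r)
        - ((- n\<^sup>2 * F r) * sin (n * r) + n * cos (n * r) * F1 r) / n = 0"
      using n by (simp add: field_simps power2_eq_square)
    ultimately show ?thesis by (simp only:)
  qed
  have dY: "(Y has_real_derivative 0) (at r)" if r: "r \<in> {0..s}" for r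
  proof -
    have "(Y has_real_derivative (F1 r * sin (n * r) + n * cos (n * r) * F r)
        + ((- n\<^sup>2 * F r) * cos (n * r) + - n * sin (n * r) * F1 r) / n) (at r)"
      unfolding Y_def by (intro DERIV_add DERIV_cdivide DERIV_mult dF[OF r] dF1[OF r] dsin dcos)
    moreover have "(F1 r * sin (n * r) + n * cos (n * r) * F r)
        + ((- n\<^sup>2 * F r) * cos (n * r) + - n * sin (n * r) * F1 r) / n = 0"
      using n by (simp add: field_simps power2_eq_square)
    ultimately show ?thesis by (simp only:)
  qed
  have const: "Z s = Z 0" if dZ: "\<And>r. r \<in> {0..s} \<Longrightarrow> (Z has_real_derivative 0) (at r)" for Z :: "real \<Rightarrow> real"
  proof -
    obtain c where "\<And>x. x \<in> {0..s} \<Longrightarrow> Z x = c"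
      using has_field_derivative_zero_constant[of "{0..s}" Z]
        has_field_derivative_at_within[OF dZ] by blast
    then show ?thesis using s by simp
  qed
  have p0: "conical_series n 0 = 1" by (simp add: conical_series_def)
  have "X s = 1" using const[OF dX] by (simp add: X_def F_def F1_def q_def p0)
  moreover have "Y s = 0" using const[OF dY] by (simp add: Y_def F_def F1_def q_def p0)
  moreover have "F s = X s * cos (n * s) + Y s * sin (n * s)"
  proof -
    have "X s * cos (n * s) + Y s * sin (n * s) =
        F s * (cos (n * s) * cos (n * s)) + F s * (sin (n * s) * sin (n * s))"
      unfolding X_def Y_def by (simp add: field_simps)
    also have "\<dots> = F s" by (simp only: distrib_left[symmetric] sin_cos_squared_add3 mult_1_right)
    finally show ?thesis by simp
  qed
  ultimately show ?thesis by (simp add: F_def q_def)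
qed

text \<open>The closed form of the series, meaningful for all v >= 0 and not only in the disc of
  convergence: \<open>arsinh (sqrt v)\<close> is s/2 when v = sinh(s/2)^2.\<close>

definition conical_ker :: "real \<Rightarrow> real \<Rightarrow> real" where
  "conical_ker n v = cos (2 * n * arsinh (sqrt v)) / sqrt (1 + v)"

lemma conical_ker_eq_series:
  assumes v: "0 \<le> v" "v < 1" and n: "n > 0"
  shows "conical_ker n v = conical_series n v"
proof -
  define s where "s = 2 * arsinh (sqrt v)"
  have sh: "sinh (s/2) = sqrt v" by (simp add: s_def)
  have ch: "cosh (s/2) = sqrt (1 + v)" using v by (simp add: s_def cosh_arsinh_real add.commute)
  have "s \<ge> 0" using v using arsinh_real_neg_iff[of "sqrt v"] by (simp add: s_def not_less[symmetric] del: arsinh_real_neg_iff)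
  moreover have "sinh (s/2) < 1" using v by (simp add: sh)
  ultimately have "cosh (s/2) * conical_series n ((sinh (s/2))\<^sup>2) = cos (n * s)"
    by (rule conical_series_sinh[OF _ _ n])
  then have "sqrt (1 + v) * conical_series n v = cos (n * s)" using v by (simp only: sh ch) simp
  moreover have "n * s = 2 * n * arsinh (sqrt v)" by (simp add: s_def)
  moreover have "sqrt (1 + v) \<noteq> 0" using v by simp
  ultimately show ?thesis unfolding conical_ker_def by (simp add: field_simps)
qed

text \<open>The continuation of conical_ker to the half-plane Re v > 0; there the two square roots and the
  logarithm stay off their branch cuts.\<close>

definition conical_cker :: "real \<Rightarrow> complex \<Rightarrow> complex" where
  "conical_cker n v = cos (2 * of_real n * Ln (csqrt v + csqrt (1 + v))) / csqrt (1 + v)"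

lemma conical_cker_of_real:
  assumes "v > 0"
  shows "conical_cker n (of_real v) = of_real (conical_ker n v)"
proof -
  have pos: "sqrt v + sqrt (1 + v) > 0" using assms by (simp add: add_pos_pos)
  have a: "csqrt (of_real v) = of_real (sqrt v)" "csqrt (1 + of_real v) = of_real (sqrt (1 + v))"
    using assms of_real_sqrt[of v] of_real_sqrt[of "1+v"] by auto
  have "Ln (csqrt (of_real v) + csqrt (1 + of_real v)) = of_real (arsinh (sqrt v))"
    unfolding a of_real_add[symmetric] using Ln_of_real[OF pos] assms
    by (simp add: arsinh_real_def add.commute)
  moreover have "2 * of_real n * complex_of_real (arsinh (sqrt v)) = of_real (2 * n * arsinh (sqrt v))"
    by simp
  ultimately show ?thesis unfolding conical_cker_def conical_ker_def a(2)
    by (simp only: cos_of_real of_real_divide)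
qed

lemma Re_csqrt_pos: "Re v > 0 \<Longrightarrow> Re (csqrt v) > 0"
  by (simp add: add_nonneg_pos)

lemma nonpos_Reals_Re_pos: "Re z > 0 \<Longrightarrow> z \<notin> \<real>\<^sub>\<le>\<^sub>0"
  by (auto simp: complex_nonpos_Reals_iff)

lemma holomorphic_conical_cker: "conical_cker n holomorphic_on {v. Re v > 0}"
proof -
  have 1: "csqrt (1 + v) \<noteq> 0" if "Re v > 0" for v
    using Re_csqrt_pos[of "1 + v"] that by (metis add_pos_pos plus_complex.sel(1) one_complex.sel(1) zero_complex.sel(1) less_irrefl zero_less_one)
  have 2: "Re (csqrt v + csqrt (1 + v)) > 0" if "Re v > 0" for v
    unfolding plus_complex.sel by (intro add_pos_pos Re_csqrt_pos) (use that in auto)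
  show ?thesis
    unfolding conical_cker_def[abs_def]
    by (intro holomorphic_intros holomorphic_on_csqrt' holomorphic_on_Ln' nonpos_Reals_Re_pos)
       (use 1 2 in auto)
qed

text \<open>A bound independent of v, as domination of the parameter integral requires: |cos w| <=
  exp |Im w|, the principal logarithm has imaginary part at most pi in modulus, and |1 + v| >= 1
  bounds the denominator below.\<close>

lemma norm_conical_cker_le:
  assumes "Re v > 0"
  shows "norm (conical_cker n v) \<le> exp (2 * \<bar>n\<bar> * pi)"
proof -
  define q where "q = csqrt v + csqrt (1 + v)"
  have "Re q > 0" unfolding q_def plus_complex.sel
    by (intro add_pos_pos Re_csqrt_pos) (use assms in auto)
  then have "q \<noteq> 0" by auto
  then have "\<bar>Im (Ln q)\<bar> \<le> pi" using Im_Ln_le_pi[of q] mpi_less_Im_Ln[of q] by simp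
  then have im: "\<bar>Im (2 * of_real n * Ln q)\<bar> \<le> 2 * \<bar>n\<bar> * pi"
    by (simp add: abs_mult mult_left_mono)
  have "norm (cos (2 * of_real n * Ln q)) \<le> exp \<bar>Im (2 * of_real n * Ln q)\<bar>"
  proof -
    have "norm (cos w) \<le> exp \<bar>Im w\<bar>" for w
    proof -
      have "norm (cos w) \<le> (norm (exp (\<i> * w)) + norm (exp (- \<i> * w))) / 2"
        using norm_triangle_ineq[of "exp (\<i> * w)" "exp (- \<i> * w)"]
        unfolding cos_exp_eq norm_divide by simp
      also have "\<dots> = (exp (- Im w) + exp (Im w)) / 2" by simp
      also have "\<dots> \<le> (exp \<bar>Im w\<bar> + exp \<bar>Im w\<bar>) / 2"
        by (intro divide_right_mono add_mono) auto
      finally show ?thesis by simp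
    qed
    then show ?thesis .
  qed
  also have "\<dots> \<le> exp (2 * \<bar>n\<bar> * pi)" using im by simp
  finally have 1: "norm (cos (2 * of_real n * Ln q)) \<le> exp (2 * \<bar>n\<bar> * pi)" .
  have "1 \<le> Re (1 + v)" using assms by simp
  also have "\<dots> \<le> norm (1 + v)" by (rule complex_Re_le_cmod)
  finally have "1 \<le> norm (csqrt (1 + v))" by (simp add: norm_csqrt)
  then have "norm (cos (2 * of_real n * Ln q)) / norm (csqrt (1 + v)) \<le> exp (2 * \<bar>n\<bar> * pi) / 1"
    using 1 by (intro frac_le) auto
  then show ?thesis by (simp add: conical_cker_def norm_divide q_def)
qed

lemma abs_conical_ker_le_1: "v \<ge> 0 \<Longrightarrow> \<bar>conical_ker n v\<bar> \<le> 1"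
proof -
  assume "v \<ge> 0"
  then have "\<bar>cos (2 * n * arsinh (sqrt v))\<bar> / sqrt (1 + v) \<le> 1 / 1"
    by (intro frac_le) auto
  then show ?thesis using \<open>v \<ge> 0\<close> by (simp add: conical_ker_def)
qed

section \<open>The inner integral of the Mehler-Fock transform\<close>

lemma tail_ratio_limits:
  fixes a z :: real
  assumes "a + z > 0"
  shows "((\<lambda>t. (t - a) / (t + z)) \<longlongrightarrow> 0) (at_right a)"
    and "((\<lambda>t. (t - a) / (t + z)) \<longlongrightarrow> 1) at_top"
proof -
  have "((\<lambda>t. (t - a) / (t + z)) \<longlongrightarrow> (a - a) / (a + z)) (at a within {a<..})"
    by (intro tendsto_intros) (use assms in auto)
  then show "((\<lambda>t. (t - a) / (t + z)) \<longlongrightarrow> 0) (at_right a)" by simp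
  have "filterlim (\<lambda>t. z + t) at_top at_top"
    by (rule filterlim_tendsto_add_at_top[OF tendsto_const filterlim_ident])
  then have "((\<lambda>t. 1 - (a + z) / (z + t)) \<longlongrightarrow> 1 - 0) at_top"
    by (intro tendsto_intros tendsto_divide_0[OF tendsto_const] filterlim_at_top_imp_at_infinity)
  moreover have "\<forall>\<^sub>F t in at_top. 1 - (a + z) / (z + t) = (t - a) / (t + z)"
    using eventually_gt_at_top[of "-z"] by eventually_elim (simp add: field_simps)
  ultimately show "((\<lambda>t. (t - a) / (t + z)) \<longlongrightarrow> 1) at_top"
    by (simp add: tendsto_cong)
qed

text \<open>The integrand has the antiderivative ((t - a)/(t + z))^(1/2 - m) / ((1/2 - m)(a + z)).
  Since 1/2 - m > 0, the power runs from 0 at t = a to 1 at infinity. Nonnegativity of the integrand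
  makes integrability part of the conclusion.\<close>

lemma tail_integral_real:
  fixes a z m :: real
  assumes az: "a + z > 0" and m: "m < 1/2"
  shows "set_integrable lborel {a<..} (\<lambda>t. (t - a) powr (- m - 1/2) * (t + z) powr (m - 3/2))"
    and "(LINT t:{a<..}|lborel. (t - a) powr (- m - 1/2) * (t + z) powr (m - 3/2)) = 1 / ((1/2 - m) * (a + z))"
proof -
  let ?c = "1/2 - m"
  let ?f = "\<lambda>t. (t - a) powr (- m - 1/2) * (t + z) powr (m - 3/2)"
  let ?F = "\<lambda>t. ((t - a) / (t + z)) powr ?c / (?c * (a + z))"
  have c: "?c > 0" using m by simp
  have D: "(?F has_real_derivative ?f t) (at t)" if t: "t > a" for t
  proof -
    have pos: "t - a > 0" "t + z > 0" "(t - a) / (t + z) > 0" using t az by auto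
    have "((\<lambda>t. (t - a) / (t + z)) has_real_derivative (a + z) / (t + z)\<^sup>2) (at t)"
      using pos by (auto intro!: derivative_eq_intros simp: power2_eq_square)
    from DERIV_cdivide[OF DERIV_fun_powr[OF this pos(3), of ?c]]
    have "(?F has_real_derivative
        (?c * ((t - a) / (t + z)) powr (?c - 1) * ((a + z) / (t + z)\<^sup>2)) / (?c * (a + z))) (at t)"
      by (simp only: of_nat_1)
    moreover have "(?c * ((t - a) / (t + z)) powr (?c - 1) * ((a + z) / (t + z)\<^sup>2)) / (?c * (a + z)) = ?f t"
    proof -
      have "((t - a) / (t + z)) powr (?c - 1) = (t - a) powr (- m - 1/2) / (t + z) powr (- m - 1/2)"
      proof -
        have "?c - 1 = - m - 1/2" by simp
        then show ?thesis using pos by (simp only: powr_divide less_imp_le)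
      qed
      moreover have "(t + z) powr (m - 3/2) = 1 / ((t + z) powr (- m - 1/2) * (t + z)\<^sup>2)"
      proof -
        have "(t + z) powr (m - 3/2) * ((t + z) powr (- m - 1/2) * (t + z) powr 2) = 1"
        proof -
          have "m - 3/2 + (- m - 1/2 + 2) = 0" by simp
          then show ?thesis using pos by (simp only: powr_add[symmetric] powr_zero_eq_one) simp
        qed
        then show ?thesis using pos by (simp add: powr_numeral field_simps)
      qed
      ultimately show ?thesis using c az by simp
    qed
    ultimately show ?thesis by simp
  qed
  have e: "einterval (ereal a) \<infinity> = {a<..}" by (auto simp: einterval_def)
  have cont: "isCont ?f t" if "t > a" for t
    using that az by (intro continuous_intros) auto
  have L0: "((?F \<circ> real_of_ereal) \<longlongrightarrow> 0) (at_right (ereal a))"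
  proof -
    have "((\<lambda>t. ((t - a) / (t + z)) powr ?c) \<longlongrightarrow> 0) (at_right a)"
    proof (rule tendsto_zero_powrI[OF tail_ratio_limits(1)[OF az] tendsto_const _ c])
      show "\<forall>\<^sub>F t in at_right a. 0 \<le> (t - a) / (t + z)"
        using eventually_at_right_less[of a] by eventually_elim (use az in auto)
    qed
    then have "(?F \<longlongrightarrow> 0 / (?c * (a + z))) (at_right a)"
      by (rule tendsto_divide[OF _ tendsto_const]) (use c az in auto)
    then show ?thesis by (simp add: ereal_tendsto_simps)
  qed
  have L1: "((?F \<circ> real_of_ereal) \<longlongrightarrow> 1 / (?c * (a + z))) (at_left \<infinity>)"
  proof -
    have "((\<lambda>t. ((t - a) / (t + z)) powr ?c) \<longlongrightarrow> 1 powr ?c) at_top"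
      by (rule tendsto_powr[OF tail_ratio_limits(2)[OF az] tendsto_const]) simp
    then have "(?F \<longlongrightarrow> 1 powr ?c / (?c * (a + z))) at_top"
      by (rule tendsto_divide[OF _ tendsto_const]) (use c az in auto)
    then show ?thesis by (simp add: ereal_tendsto_simps)
  qed
  note FTC = interval_integral_FTC_nonneg[where a="ereal a" and b=\<infinity> and f="?f" and F="?F", OF _ _ _ _ L0 L1]
  show "set_integrable lborel {a<..} ?f"
    using FTC(1) D cont by (simp add: e)
  have "(LBINT t=ereal a..\<infinity>. ?f t) = 1 / (?c * (a + z)) - 0"
    by (rule FTC(2)) (use D cont in auto)
  then show "(LINT t:{a<..}|lborel. ?f t) = 1 / (?c * (a + z))"
    by (simp add: interval_integral_to_infinity_eq)
qed

text \<open>The same antiderivative with a complex exponent. Integrability is inherited from the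
  real case, because the norm of the integrand is the real integrand with m = Re mu.\<close>

lemma tail_integral_complex:
  fixes a z :: real and mu :: complex
  assumes az: "a + z > 0" and mu: "Re mu < 1/2"
  shows "(LINT t:{a<..}|lborel. cpow (t - a) (- mu - 1/2) * cpow (t + z) (mu - 3/2)) =
      1 / ((1/2 - mu) * of_real (a + z))"
proof -
  let ?c = "1/2 - mu"
  let ?f = "\<lambda>t. cpow (t - a) (- mu - 1/2) * cpow (t + z) (mu - 3/2)"
  let ?F = "\<lambda>t. cpow ((t - a) / (t + z)) ?c / (?c * of_real (a + z))"
  have c: "?c \<noteq> 0" "Re ?c > 0" using mu by (auto simp: complex_eq_iff)
  have e: "einterval (ereal a) \<infinity> = {a<..}" by (auto simp: einterval_def)
  have D: "(?F has_vector_derivative ?f t) (at t)" if t: "t > a" for t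
  proof -
    have pos: "t - a > 0" "t + z > 0" using t az by auto
    have "((\<lambda>t. (t - a) / (t + z)) has_real_derivative (a + z) / (t + z)\<^sup>2) (at t)"
      using pos by (auto intro!: derivative_eq_intros simp: power2_eq_square)
    from DERIV_chain2[OF DERIV_ln[of "(t - a) / (t + z)"] this]
    have "((\<lambda>t. ln ((t - a) / (t + z))) has_real_derivative (a + z) / ((t - a) * (t + z))) (at t)"
      using pos by (simp add: power2_eq_square)
    then have "((\<lambda>t. ?c * complex_of_real (ln ((t - a) / (t + z)))) has_vector_derivative
        ?c * of_real ((a + z) / ((t - a) * (t + z)))) (at t)"
      by (intro has_vector_derivative_mult_right has_vector_derivative_of_real)
         (simp add: has_real_derivative_iff_has_vector_derivative)
    then have "((exp \<circ> (\<lambda>t. ?c * complex_of_real (ln ((t - a) / (t + z))))) has_vector_derivative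
        (?c * of_real ((a + z) / ((t - a) * (t + z)))) * exp (?c * complex_of_real (ln ((t - a) / (t + z))))) (at t)"
      by (rule field_vector_diff_chain_at) (rule DERIV_exp)
    then have "((\<lambda>t. cpow ((t - a) / (t + z)) ?c) has_vector_derivative
        (?c * of_real ((a + z) / ((t - a) * (t + z)))) * cpow ((t - a) / (t + z)) ?c) (at t)"
      by (simp add: cpow_def o_def)
    then have "(?F has_vector_derivative
        (?c * of_real ((a + z) / ((t - a) * (t + z)))) * cpow ((t - a) / (t + z)) ?c / (?c * of_real (a + z))) (at t)"
      by (rule has_vector_derivative_divide)
    moreover have "(?c * of_real ((a + z) / ((t - a) * (t + z)))) * cpow ((t - a) / (t + z)) ?c / (?c * of_real (a + z)) = ?f t"
    proof -
      have "cpow (t - a) (- mu - 1/2) = cpow (t - a) (?c + (-1))"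
        by (rule arg_cong[where f="cpow (t - a)"]) (simp add: complex_eq_iff)
      also have "\<dots> = cpow (t - a) ?c / of_real (t - a)"
        using pos by (simp only: cpow_add) (simp add: cpow_def exp_minus exp_of_real field_simps)
      finally have 1: "cpow (t - a) (- mu - 1/2) = cpow (t - a) ?c / of_real (t - a)" .
      have "cpow (t + z) (mu - 3/2) = cpow (t + z) (- ?c + (-1))"
        by (rule arg_cong[where f="cpow (t + z)"]) (simp add: complex_eq_iff)
      also have "\<dots> = inverse (cpow (t + z) ?c) / of_real (t + z)"
        using pos by (simp only: cpow_add cpow_minus) (simp add: cpow_def exp_minus exp_of_real field_simps)
      finally have 2: "cpow (t + z) (mu - 3/2) = inverse (cpow (t + z) ?c) / of_real (t + z)" .
      have 3: "cpow ((t - a) / (t + z)) ?c = cpow (t - a) ?c / cpow (t + z) ?c"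
        by (rule cpow_divide[OF pos])
      have nz: "complex_of_real (a + z) \<noteq> 0" using az by (simp only: of_real_eq_0_iff)
      show ?thesis unfolding 1 2 3 of_real_divide of_real_mult using c nz by (simp add: divide_simps)
    qed
    ultimately show ?thesis by simp
  qed
  have cont: "isCont ?f t" if "t > a" for t
    using that az unfolding cpow_def by (intro continuous_intros) auto
  have nrm: "norm (?f t) = (t - a) powr (- Re mu - 1/2) * (t + z) powr (Re mu - 3/2)" if "t > a" for t
    using that az by (simp add: norm_mult norm_cpow)
  have int: "set_integrable lborel {a<..} ?f"
    by (rule set_integrable_bound[OF tail_integral_real(1)[OF az mu]])
       (use nrm in \<open>auto simp: set_borel_measurable_def\<close>)
  \<comment> \<open>The limit is taken through norms, since the phase of a complex power may
    oscillate as its base tends to 0.\<close>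
  have L0: "((?F \<circ> real_of_ereal) \<longlongrightarrow> 0) (at_right (ereal a))"
  proof -
    have "((\<lambda>t. ((t - a) / (t + z)) powr Re ?c) \<longlongrightarrow> 0) (at_right a)"
    proof (rule tendsto_zero_powrI[OF tail_ratio_limits(1)[OF az] tendsto_const _ c(2)])
      show "\<forall>\<^sub>F t in at_right a. 0 \<le> (t - a) / (t + z)"
        using eventually_at_right_less[of a] by eventually_elim (use az in auto)
    qed
    moreover have "\<forall>\<^sub>F t in at_right a. ((t - a) / (t + z)) powr Re ?c = norm (cpow ((t - a) / (t + z)) ?c)"
      using eventually_at_right_less[of a] by eventually_elim (rule norm_cpow[symmetric], use az in auto)
    ultimately have "((\<lambda>t. norm (cpow ((t - a) / (t + z)) ?c)) \<longlongrightarrow> 0) (at_right a)"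
      by (rule Lim_transform_eventually)
    then have "((\<lambda>t. cpow ((t - a) / (t + z)) ?c) \<longlongrightarrow> 0) (at_right a)"
      by (rule tendsto_norm_zero_cancel)
    then have "(?F \<longlongrightarrow> 0 / (?c * of_real (a + z))) (at_right a)"
      by (rule tendsto_divide[OF _ tendsto_const]) (use c az in \<open>simp flip: of_real_add\<close>)
    then show ?thesis by (simp add: ereal_tendsto_simps)
  qed
  have L1: "((?F \<circ> real_of_ereal) \<longlongrightarrow> 1 / (?c * of_real (a + z))) (at_left \<infinity>)"
  proof -
    have "((\<lambda>t. cpow ((t - a) / (t + z)) ?c) \<longlongrightarrow> exp (?c * of_real (ln 1))) at_top"
      unfolding cpow_def by (intro tendsto_intros tail_ratio_limits(2)[OF az]) simp
    then have "(?F \<longlongrightarrow> exp (?c * of_real (ln 1)) / (?c * of_real (a + z))) at_top"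
      by (rule tendsto_divide[OF _ tendsto_const]) (use c az in \<open>simp flip: of_real_add\<close>)
    then show ?thesis by (simp add: ereal_tendsto_simps)
  qed
  have "(LBINT t=ereal a..\<infinity>. ?f t) = 1 / (?c * of_real (a + z)) - 0"
    by (rule interval_integral_FTC_integrable[where F="?F", OF _ _ _ _ L0 L1])
       (use D cont int in \<open>auto simp: e\<close>)
  then show ?thesis by (simp add: interval_integral_to_infinity_eq)
qed

section \<open>The Fourier transform of 1/(cosh s + cosh u)\<close>

text \<open>The substitution y = \<open>logistic s\<close> carries the real line to (0, 1) with y/(1
  - y) = exp s. It turns a Beta integral into a Fourier integral; \<open>logistic_d\<close> is the
  Jacobian.\<close>

definition logistic :: "real \<Rightarrow> real" where "logistic s = 1 / (1 + exp (- s))"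
definition logistic_d :: "real \<Rightarrow> real" where "logistic_d s = 1 / (2 * (1 + cosh s))"

lemma cosh_real_plus_pos: "1 + cosh (s::real) > 0" "cosh (s::real) + cosh u > 0"
  using cosh_real_ge_1[of s] cosh_real_ge_1[of u] by linarith+

lemma logistic_d_eq: "logistic_d s = logistic s * (1 - logistic s)"
proof -
  have e: "1 + exp (- s) \<noteq> 0" using exp_gt_zero[of "- s"] by linarith
  have "logistic s * (1 - logistic s) = exp (- s) / (1 + exp (- s))\<^sup>2"
    unfolding logistic_def using e by (simp add: field_simps power2_eq_square)
  also have "(1 + exp (- s))\<^sup>2 = exp (- s) * (2 * (1 + cosh s))"
  proof -
    have "exp s * exp (- s) = 1" by (simp flip: exp_add)
    then show ?thesis by (simp add: cosh_def field_simps power2_eq_square)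
  qed
  finally show ?thesis by (simp add: logistic_d_def)
qed

lemma logistic_deriv: "(logistic has_real_derivative logistic_d s) (at s)"
proof -
  have e: "1 + exp (- s) > 0" using exp_gt_zero[of "- s"] by linarith
  have "(logistic has_real_derivative exp (- s) / (1 + exp (- s))\<^sup>2) (at s)"
    unfolding logistic_def[abs_def]
    using e by (auto intro!: derivative_eq_intros simp: power2_eq_square)
  moreover have "exp (- s) / (1 + exp (- s))\<^sup>2 = logistic_d s"
    unfolding logistic_d_eq logistic_def using e by (simp add: field_simps power2_eq_square)
  ultimately show ?thesis by simp
qed

lemma logistic_d_nonneg: "logistic_d s \<ge> 0"
  using cosh_real_plus_pos(1)[of s] by (simp add: logistic_d_def)

lemma logistic_d_cont: "isCont logistic_d s"
  unfolding logistic_d_def[abs_def] using cosh_real_plus_pos(1)[of s] by (intro continuous_intros) auto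

lemma logistic_d_measurable [measurable]: "logistic_d \<in> borel_measurable borel"
  by (intro borel_measurable_continuous_onI continuous_at_imp_continuous_on) (auto simp: logistic_d_cont)

lemma logistic_limits: "(logistic \<longlongrightarrow> 0) at_bot" "(logistic \<longlongrightarrow> 1) at_top"
proof -
  have 1: "filterlim (\<lambda>s::real. 1 + exp (- s)) at_top at_bot"
    by (intro filterlim_tendsto_add_at_top[OF tendsto_const] filterlim_compose[OF exp_at_top]
        filterlim_uminus_at_top_at_bot)
  show "(logistic \<longlongrightarrow> 0) at_bot"
    unfolding logistic_def[abs_def]
    by (intro tendsto_divide_0[OF tendsto_const] filterlim_at_top_imp_at_infinity 1)
  have "((\<lambda>s::real. 1 / (1 + exp (- s))) \<longlongrightarrow> 1 / (1 + 0)) at_top"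
    by (intro tendsto_intros filterlim_compose[OF exp_at_bot] filterlim_uminus_at_bot_at_top) auto
  then show "(logistic \<longlongrightarrow> 1) at_top" by (simp add: logistic_def[abs_def])
qed

lemma logistic_bounds: "0 < logistic s" "logistic s < 1"
  by (auto simp: logistic_def divide_simps add_pos_pos)

lemma integrable_logistic_d: "integrable lborel logistic_d" "(\<integral>s. logistic_d s \<partial>lborel) = 1"
proof -
  have L: "((logistic \<circ> real_of_ereal) \<longlongrightarrow> 0) (at_right (-\<infinity>))"
    "((logistic \<circ> real_of_ereal) \<longlongrightarrow> 1) (at_left \<infinity>)"
    using logistic_limits by (simp_all add: ereal_tendsto_simps)
  note FTC = interval_integral_FTC_nonneg[where a="-\<infinity>" and b=\<infinity> and f=logistic_d and F=logistic, OF _ _ _ _ L]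
  have "set_integrable lborel (einterval (-\<infinity>) \<infinity>) logistic_d"
    by (rule FTC(1)) (auto simp: logistic_deriv logistic_d_cont logistic_d_nonneg)
  then show "integrable lborel logistic_d" by (simp add: set_integrable_def)
  have "(LBINT s=-\<infinity>..\<infinity>. logistic_d s) = 1 - 0"
    by (rule FTC(2)) (auto simp: logistic_deriv logistic_d_cont logistic_d_nonneg)
  then show "(\<integral>s. logistic_d s \<partial>lborel) = 1"
    by (simp add: interval_lebesgue_integral_def set_lebesgue_integral_def)
qed

lemma integrable_logistic_d_exp:
  "integrable lborel (\<lambda>s. logistic_d s *\<^sub>R exp (\<i> * of_real (n * s)))"
proof (rule Bochner_Integration.integrable_bound[OF integrable_logistic_d(1)])
  show "AE s in lborel. norm (logistic_d s *\<^sub>R exp (\<i> * of_real (n * s))) \<le> norm (logistic_d s)"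
    by (intro AE_I2) (simp add: norm_mult)
qed simp

text \<open>For y = \<open>logistic s\<close>, y^(in) (1 - y)^(-in) = exp(ins), so the transform is
  Beta(1 + in, 1 - in) = Gamma(1 + in) Gamma(1 - in). The reflection formula and sin(i pi n) = i
  sinh(pi n) give the value.\<close>

lemma logistic_d_fourier:
  assumes n: "n > 0"
  shows "(\<integral>s. logistic_d s *\<^sub>R exp (\<i> * of_real (n * s)) \<partial>lborel) = of_real (pi * n / sinh (pi * n))"
proof -
  let ?a = "1 + \<i> * of_real n" and ?b = "1 - \<i> * of_real n"
  let ?f = "\<lambda>y. cpow y (?a - 1) * cpow (1 - y) (?b - 1)"
  have comp: "?f (logistic s) = exp (\<i> * of_real (n * s))" for s
  proof -
    have b: "logistic s > 0" "1 - logistic s > 0" using logistic_bounds[of s] by auto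
    have "1 + exp (- s) \<noteq> 0" using exp_gt_zero[of "- s"] by linarith
    then have "logistic s / (1 - logistic s) = exp s"
      by (simp add: logistic_def field_simps exp_minus)
    then have "ln (logistic s) - ln (1 - logistic s) = s"
      using ln_div[of "logistic s" "1 - logistic s"] b by simp
    then have "complex_of_real (ln (logistic s)) - of_real (ln (1 - logistic s)) = of_real s"
      by (simp flip: of_real_diff)
    moreover have "?f (logistic s) = exp (\<i> * of_real n * (complex_of_real (ln (logistic s)) - of_real (ln (1 - logistic s))))"
      unfolding cpow_def exp_add[symmetric] by (simp add: algebra_simps)
    ultimately show ?thesis by (simp add: mult_ac)
  qed
  have cont: "isCont ?f y" if "0 < y" "y < 1" for y
    using that unfolding cpow_def by (intro continuous_intros) auto
  have int: "set_integrable lborel {0<..<1} ?f"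
    using integrable_Beta_complex[of ?a ?b] by (simp add: set_integrable_def)
  have L: "((logistic \<circ> real_of_ereal) \<longlongrightarrow> 0) (at_right (-\<infinity>))"
    "((logistic \<circ> real_of_ereal) \<longlongrightarrow> 1) (at_left \<infinity>)"
    using logistic_limits by (simp_all add: ereal_tendsto_simps)
  have e1: "einterval 0 1 = {0<..<1::real}" by (auto simp: einterval_def)
  have "(LBINT y=0..1. ?f y) = (LBINT s=-\<infinity>..\<infinity>. logistic_d s *\<^sub>R ?f (logistic s))"
  proof (rule interval_integral_substitution_integrable)
    show "((ereal \<circ> logistic \<circ> real_of_ereal) \<longlongrightarrow> 0) (at_right (-\<infinity>))"
      "((ereal \<circ> logistic \<circ> real_of_ereal) \<longlongrightarrow> 1) (at_left \<infinity>)"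
      using L[THEN tendsto_ereal] by (simp_all only: comp_def zero_ereal_def one_ereal_def)
    show "isCont ?f (logistic x)" for x
      by (rule cont[OF logistic_bounds])
    show "set_integrable lborel (einterval (- \<infinity>) \<infinity>) (\<lambda>x. logistic_d x *\<^sub>R ?f (logistic x))"
      unfolding comp using integrable_logistic_d_exp[of n] by (simp add: set_integrable_def)
    show "set_integrable lborel (einterval 0 1) ?f" unfolding e1 by (rule int)
  qed (auto simp: logistic_deriv logistic_d_cont logistic_d_nonneg)
  also have "(LBINT y=0..1. ?f y) = Beta ?a ?b"
    using Beta_integral_complex[of ?a ?b]
    by (simp add: interval_lebesgue_integral_def e1 set_lebesgue_integral_def)
  also have "(LBINT s=-\<infinity>..\<infinity>. logistic_d s *\<^sub>R ?f (logistic s)) =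
      (\<integral>s. logistic_d s *\<^sub>R exp (\<i> * of_real (n * s)) \<partial>lborel)"
    unfolding comp by (simp add: interval_lebesgue_integral_def set_lebesgue_integral_def)
  finally have "(\<integral>s. logistic_d s *\<^sub>R exp (\<i> * of_real (n * s)) \<partial>lborel) = Beta ?a ?b" ..
  also have "Beta ?a ?b = Gamma ?a * Gamma ?b"
    by (simp add: Beta_def Gamma_numeral)
  also have "Gamma ?a = \<i> * of_real n * Gamma (\<i> * of_real n)"
  proof -
    have "\<i> * complex_of_real n \<notin> \<int>\<^sub>\<le>\<^sub>0"
      using n by (auto elim!: nonpos_Ints_cases simp: complex_eq_iff)
    then show ?thesis using Gamma_plus1[of "\<i> * of_real n"] by (simp add: add.commute)
  qed
  also have "\<i> * of_real n * Gamma (\<i> * of_real n) * Gamma ?b =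
      \<i> * of_real n * (of_real pi / sin (of_real pi * (\<i> * of_real n)))"
    by (simp only: mult.assoc Gamma_reflection_complex[of "\<i> * of_real n", unfolded mult.assoc])
  also have "sin (of_real pi * (\<i> * of_real n)) = \<i> * of_real (sinh (pi * n))"
  proof -
    have "sin (of_real pi * (\<i> * of_real n)) = sin (\<i> * complex_of_real (pi * n))" by (simp add: mult_ac)
    also have "\<dots> = \<i> * sinh (of_real (pi * n))" by (simp add: sinh_conv_sin)
    also have "sinh (complex_of_real (pi * n)) = of_real (sinh (pi * n))"
      by (simp add: complex_eq_iff sinh_def Re_exp Im_exp)
    finally show ?thesis .
  qed
  finally show ?thesis by simp
qed

text \<open>This is what reduces the kernel 1/(cosh s + cosh u) to translates of
  \<open>logistic_d\<close>: the left side is the integral of \<open>logistic_d (s + w)\<close> over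
  -u <= w <= u.\<close>

lemma logistic_diff: "logistic (s + u) - logistic (s - u) = sinh u / (cosh s + cosh u)"
proof -
  define a b where "a = exp s" and "b = exp u"
  have pos: "a > 0" "b > 0" by (auto simp: a_def b_def)
  have 1: "logistic (s + u) = a * b / (a * b + 1)"
    using pos by (simp add: logistic_def exp_add exp_diff exp_minus a_def b_def field_simps)
  have 2: "logistic (s - u) = a / (a + b)"
    using pos by (simp add: logistic_def exp_add exp_diff exp_minus a_def b_def field_simps)
  have 3: "sinh u / (cosh s + cosh u) = (b - 1 / b) / (a + 1 / a + (b + 1 / b))"
  proof -
    have "sinh u = (b - 1 / b) / 2" "cosh s + cosh u = (a + 1 / a + (b + 1 / b)) / 2"
      by (auto simp: sinh_def cosh_def exp_minus a_def b_def field_simps)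
    moreover have "(p / 2) / (q / 2) = p / q" for p q :: real by simp
    ultimately show ?thesis by (simp only:)
  qed
  have 4: "a + 1 / a + (b + 1 / b) = (a * b + 1) * (a + b) / (a * b)"
    using pos by (simp add: field_simps)
  have 5: "b - 1 / b = (b * b - 1) / b" using pos by (simp add: field_simps)
  have nz: "a * b + 1 \<noteq> 0" "a + b \<noteq> 0" using pos by (auto simp: add_pos_pos less_imp_neq[symmetric])
  have "a * b / (a * b + 1) - a / (a + b) = (a * b * (a + b) - a * (a * b + 1)) / ((a * b + 1) * (a + b))"
    by (rule diff_frac_eq[OF nz])
  also have "a * b * (a + b) - a * (a * b + 1) = a * (b * b - 1)" by (simp add: algebra_simps)
  also have "a * (b * b - 1) / ((a * b + 1) * (a + b)) = (b * b - 1) / b / ((a * b + 1) * (a + b) / (a * b))"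
    using pos by simp
  finally show ?thesis by (simp only: 1 2 3 4 5)
qed

text \<open>The kernel is an average of translates of \<open>logistic_d\<close>, and translation by
  w multiplies the Fourier transform by exp(-inw). After Fubini, integrating that phase over [-u, u]
  produces 2 sin(nu)/n.\<close>

lemma exp_logistic_fourier:
  assumes n: "n > 0" and u: "u > 0"
  shows "integrable lborel (\<lambda>s. (sinh u / (cosh s + cosh u)) *\<^sub>R exp (\<i> * of_real (n * s)))"
    and "(\<integral>s. (sinh u / (cosh s + cosh u)) *\<^sub>R exp (\<i> * of_real (n * s)) \<partial>lborel) =
        of_real (2 * pi * sin (n * u) / sinh (pi * n))"
proof -
  define f where "f = (\<lambda>w s. indicator {-u..u} w *\<^sub>R (logistic_d (s + w) *\<^sub>R exp (\<i> * of_real (n * s))))"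
  have meas: "case_prod f \<in> borel_measurable (lborel \<Otimes>\<^sub>M lborel)"
    unfolding f_def by measurable
  have i1: "integrable lborel (\<lambda>s. logistic_d (s + w))" for w
    using lborel_integrable_real_affine[OF integrable_logistic_d(1), of 1 w] by (simp add: add.commute)
  have v1: "(\<integral>s. logistic_d (s + w) \<partial>lborel) = 1" for w
    using lborel_integral_real_affine[of 1 logistic_d w] integrable_logistic_d(2) by (simp add: add.commute)
  have i2: "integrable lborel (f w)" for w
    unfolding f_def
    by (rule Bochner_Integration.integrable_bound[OF i1[of w]])
       (auto simp: norm_mult indicator_def logistic_d_nonneg)
  have nrm: "norm (f w s) = indicator {-u..u} w * logistic_d (s + w)" for w s
    by (simp add: f_def norm_mult logistic_d_nonneg)
  have int: "integrable (lborel \<Otimes>\<^sub>M lborel) (case_prod f)"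
  proof (rule lborel_pair.Fubini_integrable[OF meas])
    \<comment> \<open>Each translate of \<open>logistic_d\<close> has total mass 1, so only the
      indicator of the compact range of w remains.\<close>
    have "(\<lambda>w. \<integral>s. norm (case_prod f (w, s)) \<partial>lborel) = indicator {-u..u}"
      by (rule ext) (simp add: nrm v1)
    then show "integrable lborel (\<lambda>w. \<integral>s. norm (case_prod f (w, s)) \<partial>lborel)"
      using u by (simp only:) (rule integrable_real_indicator, auto)
    show "AE w in lborel. integrable lborel (\<lambda>s. case_prod f (w, s))" using i2 by simp
  qed
  have inner: "(\<integral>w. f w s \<partial>lborel) = (sinh u / (cosh s + cosh u)) *\<^sub>R exp (\<i> * of_real (n * s))" for s
  proof -
    have D: "((\<lambda>w. logistic (s + w)) has_real_derivative logistic_d (s + w)) (at w)" for w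
      using DERIV_shift[of logistic "logistic_d (s + w)" w s] logistic_deriv[of "s + w"] by (simp add: add.commute)
    have H: "has_bochner_integral lborel (\<lambda>w. logistic_d (s + w) * indicator {-u..u} w) (logistic (s + u) - logistic (s + - u))"
      by (rule has_bochner_integral_FTC_Icc_real) (use u D in \<open>auto intro!: isCont_o2[OF _ logistic_d_cont] continuous_intros\<close>)
    then have "(\<integral>w. logistic_d (s + w) * indicator {-u..u} w \<partial>lborel) = sinh u / (cosh s + cosh u)"
      using logistic_diff[of s u] by (simp add: has_bochner_integral_iff)
    moreover have "(\<integral>w. f w s \<partial>lborel) = (\<integral>w. (logistic_d (s + w) * indicator {-u..u} w) *\<^sub>R exp (\<i> * of_real (n * s)) \<partial>lborel)"
      unfolding f_def by (simp add: mult.commute)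
    ultimately show ?thesis
      using H by (simp add: has_bochner_integral_iff)
  qed
  show "integrable lborel (\<lambda>s. (sinh u / (cosh s + cosh u)) *\<^sub>R exp (\<i> * of_real (n * s)))"
    using lborel_pair.integrable_snd[OF int] unfolding inner .
  have outer: "(\<integral>s. f w s \<partial>lborel) = indicator {-u..u} w *\<^sub>R (of_real (pi * n / sinh (pi * n)) * exp (- \<i> * of_real (n * w)))" for w
  proof -
    have "(\<integral>s. logistic_d (s + w) *\<^sub>R exp (\<i> * of_real (n * s)) \<partial>lborel) =
        (\<integral>s. logistic_d (-w + 1 * s + w) *\<^sub>R exp (\<i> * of_real (n * (-w + 1 * s))) \<partial>lborel)"
      by (subst lborel_integral_real_affine[where c=1 and t="-w"]) auto
    also have "\<dots> = (\<integral>s. (logistic_d s *\<^sub>R exp (\<i> * of_real (n * s))) * exp (- \<i> * of_real (n * w)) \<partial>lborel)"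
      by (intro Bochner_Integration.integral_cong refl) (simp add: algebra_simps exp_diff exp_minus divide_inverse)
    also have "\<dots> = of_real (pi * n / sinh (pi * n)) * exp (- \<i> * of_real (n * w))"
      by (simp only: integral_mult_left_zero logistic_d_fourier[OF n])
    finally show ?thesis unfolding f_def by (cases "w \<in> {-u..u}") (simp_all add: indicator_def)
  qed
  have "(\<integral>s. (sinh u / (cosh s + cosh u)) *\<^sub>R exp (\<i> * of_real (n * s)) \<partial>lborel) =
      (\<integral>w. indicator {-u..u} w *\<^sub>R (of_real (pi * n / sinh (pi * n)) * exp (- \<i> * of_real (n * w))) \<partial>lborel)"
    using lborel_pair.integral_snd[OF int] lborel_pair.integral_fst[OF int] unfolding inner outer by simp
  also have "\<dots> = of_real (pi * n / sinh (pi * n)) * (\<integral>w. indicator {-u..u} w *\<^sub>R exp (- \<i> * of_real (n * w)) \<partial>lborel)"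
    by (subst integral_mult_right_zero[symmetric]) simp
  also have "(\<integral>w. indicator {-u..u} w *\<^sub>R exp (- \<i> * complex_of_real (n * w)) \<partial>lborel) =
      exp (- \<i> * of_real (n * u)) / (- \<i> * of_real n) - exp (- \<i> * of_real (n * (- u))) / (- \<i> * of_real n)"
  proof (rule integral_FTC_Icc)
    fix w :: real
    have "((\<lambda>w. exp (- \<i> * of_real n * w) / (- \<i> * of_real n)) has_field_derivative exp (- \<i> * of_real n * of_real w)) (at (of_real w))"
      using n by (auto intro!: derivative_eq_intros)
    from has_vector_derivative_real_field[OF this]
    show "((\<lambda>w. exp (- \<i> * complex_of_real (n * w)) / (- \<i> * of_real n)) has_vector_derivative exp (- \<i> * of_real (n * w))) (at w within {-u..u})"
      by (simp add: mult_ac)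
  qed (use u in \<open>auto intro!: continuous_intros\<close>)
  also have "\<dots> = of_real (2 * sin (n * u) / n)"
  proof -
    have "complex_of_real (sin (n * u)) = (exp (\<i> * of_real (n * u)) - exp (- \<i> * of_real (n * u))) / (2 * \<i>)"
      by (simp only: sin_of_real[symmetric] sin_exp_eq mult_minus_left)
    then have "complex_of_real (2 * sin (n * u) / n) =
        2 * ((exp (\<i> * of_real (n * u)) - exp (- \<i> * of_real (n * u))) / (2 * \<i>)) / of_real n"
      by (simp only: of_real_divide of_real_mult of_real_numeral)
    moreover have "- \<i> * complex_of_real (n * (- u)) = \<i> * of_real (n * u)" by simp
    moreover have "Y / (- \<i> * of_real n) - X / (- \<i> * of_real n) = 2 * ((X - Y) / (2 * \<i>)) / of_real n" for X Y
      using n by (simp add: field_simps)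
    ultimately show ?thesis by (simp only:)
  qed
  finally show "(\<integral>s. (sinh u / (cosh s + cosh u)) *\<^sub>R exp (\<i> * of_real (n * s)) \<partial>lborel) =
        of_real (2 * pi * sin (n * u) / sinh (pi * n))"
    using n by simp
qed

lemma cos_cosh_integral:
  assumes n: "n > 0" and u: "u > 0"
  shows "set_integrable lborel {0<..} (\<lambda>s. cos (n * s) / (cosh s + cosh u))"
    and "sinh u * (LINT s:{0<..}|lborel. cos (n * s) / (cosh s + cosh u)) = pi * sin (n * u) / sinh (pi * n)"
proof -
  let ?E = "\<lambda>s. cos (n * s) / (cosh s + cosh u)"
  let ?C = "\<lambda>s. (sinh u / (cosh s + cosh u)) *\<^sub>R exp (\<i> * of_real (n * s))"
  have Re: "Re (?C s) = sinh u * ?E s" for s by (simp add: Re_exp)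
  have su: "sinh u > 0" using u by simp
  have iR: "integrable lborel (\<lambda>s. sinh u * ?E s)"
    using integrable_Re[OF exp_logistic_fourier(1)[OF n u]] unfolding Re .
  have iE: "integrable lborel ?E"
    using integrable_mult_right[OF iR, of "1 / sinh u"] su by simp
  have vE: "sinh u * (\<integral>s. ?E s \<partial>lborel) = 2 * pi * sin (n * u) / sinh (pi * n)"
  proof -
    have "(\<integral>s. Re (?C s) \<partial>lborel) = Re (of_real (2 * pi * sin (n * u) / sinh (pi * n)))"
      using integral_Re[OF exp_logistic_fourier(1)[OF n u]] exp_logistic_fourier(2)[OF n u] by simp
    then show ?thesis unfolding Re by (simp only: integral_mult_right_zero Re_complex_of_real)
  qed
  have ipos: "integrable lborel (\<lambda>s. indicator {0<..} s *\<^sub>R ?E s)"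
    and ineg: "integrable lborel (\<lambda>s. indicator {..<0} s *\<^sub>R ?E s)"
    by (intro integrable_mult_indicator iE; simp)+
  show "set_integrable lborel {0<..} ?E" using ipos by (simp add: set_integrable_def)
  \<comment> \<open>The integrand is even in s, so the half line carries half of the Fourier
    integral.\<close>
  have refl: "(\<integral>s. indicator {..<0} s *\<^sub>R ?E s \<partial>lborel) = (\<integral>s. indicator {0<..} s *\<^sub>R ?E s \<partial>lborel)"
    by (subst lborel_integral_real_affine[where c="-1" and t=0])
       (auto simp: indicator_def intro!: Bochner_Integration.integral_cong)
  have "(\<integral>s. ?E s \<partial>lborel) = (\<integral>s. indicator {0<..} s *\<^sub>R ?E s + indicator {..<0} s *\<^sub>R ?E s \<partial>lborel)"
  proof (rule integral_cong_AE)
    show "AE s in lborel. ?E s = indicator {0<..} s *\<^sub>R ?E s + indicator {..<0} s *\<^sub>R ?E s"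
      using AE_lborel_singleton[of 0] by eventually_elim (auto simp: indicator_def)
    show "?E \<in> borel_measurable lborel" using iE by simp
    show "(\<lambda>s. indicator {0<..} s *\<^sub>R ?E s + indicator {..<0} s *\<^sub>R ?E s) \<in> borel_measurable lborel"
      by (intro borel_measurable_add borel_measurable_integrable ipos ineg)
  qed
  also have "\<dots> = 2 * (\<integral>s. indicator {0<..} s *\<^sub>R ?E s \<partial>lborel)"
    using Bochner_Integration.integral_add[OF ipos ineg] refl by simp
  finally show "sinh u * (LINT s:{0<..}|lborel. ?E s) = pi * sin (n * u) / sinh (pi * n)"
    using vE by (simp add: set_lebesgue_integral_def)
qed

section \<open>The Fourier integral in the variable y = cosh s - 1\<close>

lemma powr_minus_half: "(y::real) \<ge> 0 \<Longrightarrow> y powr (-1/2) = inverse (sqrt y)"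
  using powr_minus[of y "1/2"] by (simp only: powr_half_sqrt minus_divide_left)

text \<open>The antiderivative is 2 arctan (sqrt y). As |\<open>conical_ker\<close>| <= 1, this
  weight is the majorant in y, here and in the later Fubini argument.\<close>

lemma set_integrable_inverse_sqrt_weight:
  "set_integrable lborel {0<..} (\<lambda>y::real. y powr (-1/2) / (1 + y))"
proof -
  let ?F = "\<lambda>y. 2 * arctan (sqrt y)"
  let ?f = "\<lambda>y::real. y powr (-1/2) / (1 + y)"
  have e: "einterval (ereal 0) \<infinity> = {0<..}" by (auto simp: einterval_def)
  have "set_integrable lborel (einterval (ereal 0) \<infinity>) ?f"
  proof (rule interval_integral_FTC_nonneg(1)[where F="?F"])
    fix y :: real assume "ereal 0 < ereal y"
    then have y: "y > 0" by simp
    have "(?F has_real_derivative 2 * (inverse (1 + (sqrt y)\<^sup>2) * (inverse (sqrt y) / 2))) (at y)"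
      by (intro DERIV_cmult DERIV_chain2[OF DERIV_arctan DERIV_real_sqrt] y)
    moreover have "2 * (inverse (1 + (sqrt y)\<^sup>2) * (inverse (sqrt y) / 2)) = ?f y"
    proof -
      have "2 * (inverse c * (b / 2)) = b / c" for b c :: real by (simp add: field_simps)
      then show ?thesis
        unfolding powr_minus_half[OF less_imp_le[OF y]] real_sqrt_pow2[OF less_imp_le[OF y]] .
    qed
    ultimately show "(?F has_real_derivative ?f y) (at y)" by simp
    show "isCont ?f y" using y by (intro continuous_intros) auto
  next
    have "((\<lambda>y. 2 * arctan (sqrt y)) \<longlongrightarrow> 2 * arctan (sqrt 0)) (at_right 0)"
      by (intro tendsto_intros)
    then show "((?F \<circ> real_of_ereal) \<longlongrightarrow> 2 * arctan (sqrt 0)) (at_right (ereal 0))"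
      by (simp only: ereal_tendsto_simps)
    have "((\<lambda>y. 2 * arctan (sqrt y)) \<longlongrightarrow> 2 * (pi / 2)) at_top"
      by (intro tendsto_intros filterlim_compose[OF tendsto_arctan_at_top] sqrt_at_top)
    then show "((?F \<circ> real_of_ereal) \<longlongrightarrow> 2 * (pi / 2)) (at_left \<infinity>)"
      by (simp only: ereal_tendsto_simps)
  qed auto
  then show ?thesis by (simp only: e)
qed

lemma conical_ker_measurable [measurable]: "conical_ker n \<in> borel_measurable borel"
  unfolding conical_ker_def[abs_def] arsinh_real_def by measurable

text \<open>Put y = cosh s - 1 = 2 sinh(s/2)^2, dy = 2 sinh(s/2) cosh(s/2) ds. The Jacobian cancels
  y^(-1/2) and the cosh(s/2) in the kernel up to sqrt 2, leaving the cosine integral over cosh s +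
  cosh u. At u = 0 both sides vanish.\<close>

lemma conical_integral:
  assumes n: "n > 0" and u: "u \<ge> 0"
  shows "sinh u * (LINT y:{0<..}|lborel. y powr (-1/2) * conical_ker n (y/2) / (1 + y + cosh u)) =
     sqrt 2 * pi * sin (n * u) / sinh (pi * n)"
proof (cases "u = 0")
  case False
  then have u: "u > 0" using u by simp
  let ?f = "\<lambda>y. y powr (-1/2) * conical_ker n (y/2) / (1 + y + cosh u)"
  let ?g = "\<lambda>s::real. cosh s - 1"
  have e: "einterval (ereal 0) \<infinity> = {0<..}" by (auto simp: einterval_def)
  have comp: "sinh s *\<^sub>R ?f (?g s) = sqrt 2 * (cos (n * s) / (cosh s + cosh u))" if s: "s > 0" for s
  proof -
    let ?S = "sinh (s/2)" and ?C = "cosh (s/2)"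
    have pos: "?S > 0" "?C > 0" using s by auto
    have c: "cosh s - 1 = 2 * ?S\<^sup>2" using cosh_double[of "s/2"] cosh_square_eq[of "s/2"] by simp
    have "?g s powr (-1/2) = 1 / sqrt (?g s)"
      using powr_minus_half[of "?g s"] cosh_real_ge_1[of s] by (simp only: inverse_eq_divide diff_ge_0_iff_ge)
    also have "\<dots> = 1 / (sqrt 2 * ?S)" using pos unfolding c by (simp add: real_sqrt_mult)
    finally have 1: "?g s powr (-1/2) = 1 / (sqrt 2 * ?S)" .
    have 2: "conical_ker n (?g s / 2) = cos (n * s) / ?C"
    proof -
      have "?g s / 2 = ?S\<^sup>2" unfolding c by simp
      moreover have "sqrt (?S\<^sup>2) = ?S" "sqrt (1 + ?S\<^sup>2) = ?C"
        using pos cosh_square_eq[of "s/2"] by (auto simp: add.commute real_sqrt_unique)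
      ultimately show ?thesis unfolding conical_ker_def by (simp add: arsinh_sinh_real mult_ac)
    qed
    have 3: "sinh s = 2 * ?S * ?C" using sinh_double[of "s/2"] by simp
    have "sinh s *\<^sub>R ?f (?g s) = 2 * ?S * ?C * (1 / (sqrt 2 * ?S) * (cos (n * s) / ?C)) / (cosh s + cosh u)"
      unfolding 1 2 real_scaleR_def by (subst 3) simp
    also have "2 * ?S * ?C * (1 / (sqrt 2 * ?S) * (cos (n * s) / ?C)) = (2 / sqrt 2) * cos (n * s)"
      using pos by simp
    also have "2 / sqrt 2 = sqrt (2::real)" by (simp add: real_div_sqrt)
    finally show ?thesis by simp
  qed
  have int1: "set_integrable lborel {0<..} (\<lambda>s. sqrt 2 * (cos (n * s) / (cosh s + cosh u)))"
    by (intro set_integrable_mult_right cos_cosh_integral(1) n u)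
  have intf: "set_integrable lborel {0<..} ?f"
  proof (rule set_integrable_bound[OF set_integrable_inverse_sqrt_weight])
    show "set_borel_measurable lborel {0<..} ?f"
      unfolding set_borel_measurable_def by measurable
    have "norm (?f y) \<le> norm (y powr (-1/2) / (1 + y))" if "y > 0" for y
    proof -
      have "\<bar>y powr (-1/2) * conical_ker n (y/2)\<bar> / (1 + y + cosh u) \<le> y powr (-1/2) * 1 / (1 + y)"
        unfolding abs_mult using that abs_conical_ker_le_1[of "y/2" n] cosh_real_pos[of u]
        by (intro frac_le mult_mono) auto
      moreover have "1 + y + cosh u > 0" using that cosh_real_ge_1[of u] by linarith
      ultimately show ?thesis using that by simp
    qed
    then show "AE y in lborel. y \<in> {0<..} \<longrightarrow> norm (?f y) \<le> norm (y powr (-1/2) / (1 + y))"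
      by auto
  qed
  have contf: "isCont ?f y" if y: "y > 0" for y
  proof -
    have nz: "sqrt (1 + y/2) \<noteq> 0" "1 + y + cosh u \<noteq> 0" "y \<noteq> 0"
      using y cosh_real_ge_1[of u] by auto
    have k: "isCont (\<lambda>y. conical_ker n (y/2)) y"
      unfolding conical_ker_def by (intro continuous_intros nz) simp_all
    show ?thesis
      using nz by (intro continuous_intros k) simp_all
  qed
  have "(LBINT y=ereal 0..\<infinity>. ?f y) = (LBINT s=ereal 0..\<infinity>. sinh s *\<^sub>R ?f (?g s))"
  proof (rule interval_integral_substitution_integrable)
    fix s :: real assume "ereal 0 < ereal s"
    then have s: "s > 0" by simp
    show "(?g has_real_derivative sinh s) (at s)" by (auto intro!: derivative_eq_intros)
    have "cosh s > 1" using cosh_real_ge_1[of s] cosh_real_one_iff[of s] s by (simp add: less_le)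
    then show "isCont ?f (?g s)" by (intro contf) simp
    show "isCont sinh s" by (intro continuous_intros)
  next
    have "((\<lambda>s::real. cosh s - 1) \<longlongrightarrow> cosh 0 - 1) (at_right 0)" by (intro tendsto_intros)
    then have "((?g \<circ> real_of_ereal) \<longlongrightarrow> 0) (at_right (ereal 0))" by (simp only: ereal_tendsto_simps) simp
    then show "((ereal \<circ> ?g \<circ> real_of_ereal) \<longlongrightarrow> ereal 0) (at_right (ereal 0))"
      using tendsto_ereal[of "?g \<circ> real_of_ereal" 0] by (simp only: comp_def)
    have "filterlim (\<lambda>s::real. -1 + cosh s) at_top at_top"
      by (rule filterlim_tendsto_add_at_top[OF tendsto_const cosh_real_at_top])
    then show "((ereal \<circ> ?g \<circ> real_of_ereal) \<longlongrightarrow> \<infinity>) (at_left \<infinity>)"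
      by (simp only: ereal_tendsto_simps) simp
    show "set_integrable lborel (einterval (ereal 0) \<infinity>) (\<lambda>s. sinh s *\<^sub>R ?f (?g s))"
      unfolding e using int1 by (rule set_integrable_cong[THEN iffD1, rotated -1]) (auto simp only: comp greaterThan_iff)
    show "set_integrable lborel (einterval (ereal 0) \<infinity>) ?f" unfolding e by (rule intf)
  qed auto
  also have "(LBINT s=ereal 0..\<infinity>. sinh s *\<^sub>R ?f (?g s)) = (LINT s:{0<..}|lborel. sqrt 2 * (cos (n * s) / (cosh s + cosh u)))"
    unfolding interval_integral_to_infinity_eq by (rule set_lebesgue_integral_cong) (auto simp only: comp greaterThan_iff, simp)
  also have "\<dots> = sqrt 2 * (LINT s:{0<..}|lborel. cos (n * s) / (cosh s + cosh u))"
    by (rule set_integral_mult_right)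
  finally have "sinh u * (LINT y:{0<..}|lborel. ?f y) = sqrt 2 * (sinh u * (LINT s:{0<..}|lborel. cos (n * s) / (cosh s + cosh u)))"
    unfolding interval_integral_to_infinity_eq by simp
  then show ?thesis unfolding cos_cosh_integral(2)[OF n u] by simp
qed simp

section \<open>The Mehler-Dirichlet formula\<close>

text \<open>The Mehler-Dirichlet integral after y = (z - 1) r. The domain no longer depends on z, so
  z may be complex; the exponents keep the shape "parameter minus 1" to fit the Beta
  integral.\<close>

definition conical_int :: "complex \<Rightarrow> real \<Rightarrow> complex \<Rightarrow> complex" where
  "conical_int mu n z = (\<integral>r. indicator {0<..<1} r *\<^sub>R
     (cpow r (1/2 - 1) * cpow (1 - r) (1/2 - mu - 1) * conical_cker n ((z - 1) / 2 * of_real r)) \<partial>lborel)"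

text \<open>For Re z > 1 and r > 0 the argument (z - 1) r / 2 stays in the right half-plane, where
  the kernel is holomorphic and uniformly bounded. The remaining weight is a Beta weight, integrable
  because Re mu < 1/2.\<close>

lemma holomorphic_conical_int:
  assumes mu: "Re mu < 1/2"
  shows "conical_int mu n holomorphic_on {z. Re z > 1}"
  unfolding conical_int_def[abs_def]
proof (rule holomorphic_on_lebesgue_integral)
  let ?w = "\<lambda>r. indicator {0<..<1} r * (r powr (1/2 - 1) * (1 - r) powr (1/2 - Re mu - 1))"
  show "open {z. Re z > 1}" by (rule open_halfspace_Re_gt)
  have Re: "Re ((z - 1) / 2 * of_real r) > 0" if "Re z > 1" "r > 0" for z r
    using that by simp
  show "(\<lambda>z. indicator {0<..<1} r *\<^sub>R (cpow r (1/2 - 1) * cpow (1 - r) (1/2 - mu - 1) *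
      conical_cker n ((z - 1) / 2 * of_real r))) holomorphic_on {z. Re z > 1}" for r :: real
  proof (cases "r \<in> {0<..<1}")
    case True
    have "(conical_cker n \<circ> (\<lambda>z. (z - 1) / 2 * of_real r)) holomorphic_on {z. Re z > 1}"
      by (rule holomorphic_on_compose_gen[OF _ holomorphic_conical_cker])
         (use True Re in \<open>auto intro!: holomorphic_intros\<close>)
    then show ?thesis using True
      by (auto simp: scaleR_conv_of_real comp_def intro!: holomorphic_intros)
  qed simp
  show "(\<lambda>r. indicator {0<..<1} r *\<^sub>R (cpow r (1/2 - 1) * cpow (1 - r) (1/2 - mu - 1) *
      conical_cker n ((z - 1) / 2 * of_real r))) \<in> borel_measurable lborel" if z: "z \<in> {z. Re z > 1}" for z
  proof -
    have c1: "continuous_on {0<..<1::real} (\<lambda>r. conical_cker n ((z - 1) / 2 * of_real r))"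
      by (rule continuous_on_compose2[OF holomorphic_on_imp_continuous_on[OF holomorphic_conical_cker]])
         (use Re z in \<open>auto intro!: continuous_intros\<close>)
    have c2: "continuous_on {0<..<1::real} (\<lambda>r. cpow r (1/2 - 1) * cpow (1 - r) (1/2 - mu - 1))"
      unfolding cpow_def by (intro continuous_intros) auto
    have "(\<lambda>r. indicator {0<..<1} r *\<^sub>R (cpow r (1/2 - 1) * cpow (1 - r) (1/2 - mu - 1) *
      conical_cker n ((z - 1) / 2 * of_real r))) \<in> borel_measurable borel"
      by (rule borel_measurable_continuous_on_indicator) (simp, rule continuous_on_mult[OF c2 c1])
    then show ?thesis by simp
  qed
  have "integrable lborel ?w" by (rule integrable_Beta_weight(1)) (use mu in auto)
  then show "integrable lborel (\<lambda>r. ?w r * exp (2 * \<bar>n\<bar> * pi))" by simp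
  show "norm (indicator {0<..<1} r *\<^sub>R (cpow r (1/2 - 1) * cpow (1 - r) (1/2 - mu - 1) *
      conical_cker n ((z - 1) / 2 * of_real r))) \<le> ?w r * exp (2 * \<bar>n\<bar> * pi)"
    if z: "z \<in> {z. Re z > 1}" for z r
  proof (cases "r \<in> {0<..<1}")
    case True
    then have nc: "norm (cpow r (1/2 - 1)) = r powr (1/2 - 1)"
      "norm (cpow (1 - r) (1/2 - mu - 1)) = (1 - r) powr (1/2 - Re mu - 1)"
      using norm_cpow[of r "1/2 - 1"] norm_cpow[of "1 - r" "1/2 - mu - 1"] by auto
    have "norm (conical_cker n ((z - 1) / 2 * of_real r)) \<le> exp (2 * \<bar>n\<bar> * pi)"
      by (rule norm_conical_cker_le) (use Re z True in auto)
    then show ?thesis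
      using True unfolding norm_mult norm_scaleR nc
      by (auto simp: indicator_def intro!: mult_left_mono)
  qed simp
qed

text \<open>Rests on (k + 1/2)^2 + n^2 = (1/2 - in + k)(1/2 + in + k). The factor (1/2)_k on the
  left is the one that the Beta integral will supply through Gamma(1/2 + k).\<close>

lemma conical_coeff_pochhammer:
  "complex_of_real (conical_coeff n k) * pochhammer (1/2) k * fact k =
     (-1) ^ k * (pochhammer (1/2 - \<i> * of_real n) k * pochhammer (1/2 + \<i> * of_real n) k)"
proof (induction k)
  case (Suc k)
  have nz: "complex_of_nat k + 1/2 \<noteq> 0" "complex_of_nat k + 1 \<noteq> 0"
    by (auto simp: complex_eq_iff)
  have "conical_coeff n (Suc k) =
      conical_coeff n k * (- ((real k + 1/2)\<^sup>2 + n\<^sup>2) / ((real k + 1/2) * (real k + 1)))"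
    by (simp add: conical_coeff_def)
  then have "complex_of_real (conical_coeff n (Suc k)) =
      of_real (conical_coeff n k) * (- ((of_nat k + 1/2)\<^sup>2 + (of_real n)\<^sup>2) / ((of_nat k + 1/2) * (of_nat k + 1)))"
    by (simp only: of_real_mult of_real_divide of_real_minus of_real_add of_real_power of_real_of_nat_eq of_real_1 of_real_numeral)
  then have "complex_of_real (conical_coeff n (Suc k)) * pochhammer (1/2) (Suc k) * fact (Suc k) =
      of_real (conical_coeff n k) * pochhammer (1/2) k * fact k *
      ((- ((of_nat k + 1/2)\<^sup>2 + (of_real n)\<^sup>2) / ((of_nat k + 1/2) * (of_nat k + 1))) * ((of_nat k + 1/2) * (of_nat k + 1)))"
    by (simp add: pochhammer_Suc add.commute mult_ac)
  also have "((- ((of_nat k + 1/2)\<^sup>2 + (of_real n)\<^sup>2) / ((of_nat k + 1/2) * (of_nat k + 1))) * ((of_nat k + 1/2) * (of_nat k + 1)))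
      = - (((1/2 - \<i> * of_real n) + of_nat k) * ((1/2 + \<i> * of_real n) + of_nat k))"
  proof -
    have "- X / Y * Y = - X" if "Y \<noteq> 0" for X Y :: complex using that by simp
    moreover have "(complex_of_nat k + 1/2) * (of_nat k + 1) \<noteq> 0" using nz by simp
    ultimately have "((- ((of_nat k + 1/2)\<^sup>2 + (of_real n)\<^sup>2) / ((of_nat k + 1/2) * (of_nat k + 1))) * ((of_nat k + 1/2) * (of_nat k + 1)))
       = - ((of_nat k + 1/2)\<^sup>2 + (complex_of_real n)\<^sup>2)" by blast
    also have "\<dots> = - (((1/2 - \<i> * of_real n) + of_nat k) * ((1/2 + \<i> * of_real n) + of_nat k))"
      by (simp add: complex_eq_iff power2_eq_square algebra_simps)
    finally show ?thesis .
  qed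
  finally show ?case unfolding Suc.IH by (simp add: pochhammer_Suc mult_ac)
qed simp

text \<open>For 1 < t < 3 the kernel argument stays below 1, so the kernel is its power series. The
  k-th term integrates to Beta(1/2 + k, 1/2 - mu): Gamma(1/2 + k) = (1/2)_k sqrt pi completes the
  Pochhammer symbols, and the denominator of the Beta value gives
  \<open>rGamma (1 - mu + of_nat k)\<close>.\<close>

lemma conical_int_local:
  assumes mu: "Re mu < 1/2" and n: "n > 0" and t: "1 < t" "t < 3"
  shows "conical_int mu n (of_real t) = of_real (sqrt pi) * Gamma (1/2 - mu) *
     hyp2F1_reg (1/2 - \<i> * of_real n) (1/2 + \<i> * of_real n) (1 - mu) (of_real ((1 - t) / 2))"
proof -
  define v where "v = (t - 1) / 2"
  have v: "0 < v" "v < 1" using t by (auto simp: v_def)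
  let ?B = "\<lambda>a r. indicator {0<..<1} r *\<^sub>R (cpow r (a - 1) * cpow (1 - r) (1/2 - mu - 1))"
  let ?c = "\<lambda>k. conical_coeff n k * v ^ k"
  let ?f = "\<lambda>k r. complex_of_real (?c k) * ?B (1/2 + of_nat k) r"
  have Bk: "?B (1/2 + of_nat k) r = ?B (1/2) r * of_real r ^ k" for k r
  proof (cases "r \<in> {0<..<1}")
    case True
    have "cpow r (1/2 + of_nat k - 1) = cpow r ((1/2 - 1) + of_nat k)" by (simp add: algebra_simps)
    also have "\<dots> = cpow r (1/2 - 1) * of_real r ^ k" using True by (simp only: cpow_add) (simp add: cpow_nat)
    finally show ?thesis by (simp add: mult_ac)
  qed simp
  have intB: "integrable lborel (?B (1/2 + of_nat k))" for k
    by (rule integrable_Beta_complex) (use mu in auto)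
  \<comment> \<open>Absolute convergence at v follows from convergence at the larger point (v +
    1)/2, still inside the unit disc.\<close>
  have sc: "summable (\<lambda>k. norm (?c k))"
  proof (rule powser_insidea)
    show "summable (\<lambda>k. conical_coeff n k * ((v + 1) / 2) ^ k)"
      by (rule summable_conical_coeff) (use v in auto)
  qed (use v in auto)
  have nf: "norm (?f k r) \<le> norm (?c k) * norm (?B (1/2) r)" for k r
  proof (cases "r \<in> {0<..<1}")
    case True
    then have "\<bar>r\<bar> ^ k \<le> 1" by (simp add: power_le_one)
    then have "norm (?B (1/2 + of_nat k) r) \<le> norm (?B (1/2) r)"
      unfolding Bk norm_mult by (simp add: norm_power mult_left_le)
    then show ?thesis unfolding norm_mult[of "complex_of_real _"] norm_of_real real_norm_def
      by (intro mult_left_mono) (auto simp only: abs_ge_zero)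
  qed simp
  have intn: "integrable lborel (\<lambda>r. norm (?B (1/2) r))" using intB[of 0] by (intro integrable_norm) simp
  have S: "(\<lambda>k. \<integral>r. ?f k r \<partial>lborel) sums (\<integral>r. (\<Sum>k. ?f k r) \<partial>lborel)"
  proof (rule sums_integral)
    show "integrable lborel (?f k)" for k by (intro integrable_mult_right intB)
    show "AE r in lborel. summable (\<lambda>k. norm (?f k r))"
    proof (rule AE_I2, rule summable_comparison_test'[where N=0])
      show "norm (norm (?f k r)) \<le> norm (?c k) * norm (?B (1/2) r)" for k r
        unfolding real_norm_def abs_norm_cancel by (rule nf[unfolded real_norm_def])
      show "summable (\<lambda>k. norm (?c k) * norm (?B (1/2) r))" for r by (rule summable_mult2[OF sc])
    qed
    show "summable (\<lambda>k. \<integral>r. norm (?f k r) \<partial>lborel)"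
    proof (rule summable_comparison_test'[where N=0])
      show "norm (\<integral>r. norm (?f k r) \<partial>lborel) \<le> norm (?c k) * (\<integral>r. norm (?B (1/2) r) \<partial>lborel)" for k
      proof -
        have "(\<integral>r. norm (?f k r) \<partial>lborel) \<le> (\<integral>r. norm (?c k) * norm (?B (1/2) r) \<partial>lborel)"
        proof (rule integral_mono)
          show "integrable lborel (\<lambda>r. norm (?f k r))" by (intro integrable_norm integrable_mult_right intB)
          show "integrable lborel (\<lambda>r. norm (?c k) * norm (?B (1/2) r))" by (intro integrable_mult_right intn)
        qed (rule nf)
        then show ?thesis by (simp only: integral_mult_right_zero) (simp add: integral_nonneg_AE)
      qed
      show "summable (\<lambda>k. norm (?c k) * (\<integral>r. norm (?B (1/2) r) \<partial>lborel))" by (rule summable_mult2[OF sc])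
    qed
  qed
  have "(\<Sum>k. ?f k r) = indicator {0<..<1} r *\<^sub>R
     (cpow r (1/2 - 1) * cpow (1 - r) (1/2 - mu - 1) * conical_cker n ((of_real t - 1) / 2 * of_real r))" for r
  proof (cases "r \<in> {0<..<1}")
    case True
    have vr: "0 < v * r" "v * r < 1" using True v mult_strict_mono[of v 1 r 1] by auto
    have "(\<lambda>k. conical_coeff n k * (v * r) ^ k) sums conical_series n (v * r)"
      unfolding conical_series_def by (rule summable_sums[OF summable_conical_coeff]) (use vr in auto)
    then have "(\<lambda>k. ?B (1/2) r * complex_of_real (conical_coeff n k * (v * r) ^ k)) sums (?B (1/2) r * of_real (conical_series n (v * r)))"
      by (intro sums_mult sums_of_real)
    also have "(\<lambda>k. ?B (1/2) r * complex_of_real (conical_coeff n k * (v * r) ^ k)) = (\<lambda>k. ?f k r)"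
      unfolding Bk by (auto simp: power_mult_distrib mult_ac)
    finally have "(\<Sum>k. ?f k r) = ?B (1/2) r * of_real (conical_series n (v * r))" by (simp add: sums_iff)
    also have "of_real (conical_series n (v * r)) = conical_cker n (of_real (v * r))"
      using conical_cker_of_real[OF vr(1), of n] conical_ker_eq_series[of "v * r" n] vr n by simp
    also have "complex_of_real (v * r) = (of_real t - 1) / 2 * of_real r" by (simp add: v_def)
    finally show ?thesis by simp
  qed simp
  then have I: "(\<integral>r. (\<Sum>k. ?f k r) \<partial>lborel) = conical_int mu n (of_real t)"
    unfolding conical_int_def by (intro Bochner_Integration.integral_cong) auto
  have T: "(\<integral>r. ?f k r \<partial>lborel) = of_real (sqrt pi) * Gamma (1/2 - mu) *
      (pochhammer (1/2 - \<i> * of_real n) k * pochhammer (1/2 + \<i> * of_real n) k * rGamma (1 - mu + of_nat k) / fact k *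
        of_real ((1 - t) / 2) ^ k)" for k
  proof -
    have "(\<integral>r. ?f k r \<partial>lborel) = of_real (?c k) * Beta (1/2 + of_nat k) (1/2 - mu)"
      using Beta_integral_complex[of "1/2 + of_nat k" "1/2 - mu"] mu
      by (simp only: integral_mult_right_zero) simp
    also have "Beta (1/2 + of_nat k) (1/2 - mu) = Gamma (1/2 + of_nat k) * Gamma (1/2 - mu) * rGamma (1 - mu + of_nat k)"
      unfolding Beta_altdef by (simp add: algebra_simps)
    also have "Gamma (1/2 + of_nat k) = pochhammer (1/2) k * complex_of_real (sqrt pi)"
    proof -
      have "(1/2::complex) \<notin> \<int>\<^sub>\<le>\<^sub>0" by (auto elim!: nonpos_Ints_cases simp: complex_eq_iff)
      then show ?thesis using pochhammer_Gamma[of "1/2::complex" k] by (simp add: Gamma_one_half_complex)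
    qed
    also have "of_real (?c k) * (pochhammer (1/2) k * complex_of_real (sqrt pi) * Gamma (1/2 - mu) * rGamma (1 - mu + of_nat k)) =
       of_real (sqrt pi) * Gamma (1/2 - mu) * ((of_real (conical_coeff n k) * pochhammer (1/2) k * fact k) * rGamma (1 - mu + of_nat k) / fact k * of_real v ^ k)"
      by simp
    also have "\<dots> = of_real (sqrt pi) * Gamma (1/2 - mu) *
      (pochhammer (1/2 - \<i> * of_real n) k * pochhammer (1/2 + \<i> * of_real n) k * rGamma (1 - mu + of_nat k) / fact k *
        of_real ((1 - t) / 2) ^ k)"
    proof -
      have "(1 - t) / 2 = - v" by (simp add: v_def field_simps)
      then have "complex_of_real ((1 - t) / 2) ^ k = (-1) ^ k * of_real v ^ k"
        by (simp only: of_real_minus power_minus[of "of_real v" k])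
      then show ?thesis unfolding conical_coeff_pochhammer by (simp only: mult_ac times_divide_eq_left times_divide_eq_right)
    qed
    finally show ?thesis .
  qed
  have C: "of_real (sqrt pi) * Gamma (1/2 - mu) \<noteq> 0"
  proof -
    have "1/2 - mu \<notin> \<int>\<^sub>\<le>\<^sub>0" using mu by (auto elim!: nonpos_Ints_cases simp: complex_eq_iff)
    then show ?thesis by (simp add: Gamma_eq_zero_iff)
  qed
  have "(\<lambda>k. pochhammer (1/2 - \<i> * of_real n) k * pochhammer (1/2 + \<i> * of_real n) k * rGamma (1 - mu + of_nat k) / fact k *
        of_real ((1 - t) / 2) ^ k) sums (conical_int mu n (of_real t) / (of_real (sqrt pi) * Gamma (1/2 - mu)))"
    using sums_divide[OF S[unfolded I T], of "of_real (sqrt pi) * Gamma (1/2 - mu)"]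
    by (simp only: nonzero_mult_div_cancel_left[OF C])
  then have "hyp2F1_reg (1/2 - \<i> * of_real n) (1/2 + \<i> * of_real n) (1 - mu) (of_real ((1 - t) / 2)) =
      conical_int mu n (of_real t) / (of_real (sqrt pi) * Gamma (1/2 - mu))"
    unfolding hyp2F1_reg_def by (rule sums_unique[symmetric])
  then show ?thesis using C by simp
qed

text \<open>Makes the choice in \<open>legendreP\<close> usable: any one continuation determines its
  value, because two continuations that agree on (1, 3) agree along the ray.\<close>

lemma legendreP_eqI:
  assumes U: "open U" "connected U" "complex_of_real ` {1<..} \<subseteq> U"
    and h: "h holomorphic_on U"
    and loc: "\<And>t. t \<in> {1<..<3} \<Longrightarrow> h (complex_of_real t) = legendreP_local mu nu t"
    and x: "x > 1"
  shows "legendreP mu nu x = h (of_real x)"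
proof -
  let ?P = "\<lambda>c. \<exists>U h. open U \<and> connected U \<and> complex_of_real ` {1<..} \<subseteq> U \<and>
        h holomorphic_on U \<and>
        (\<forall>t\<in>{1<..<3}. h (complex_of_real t) = legendreP_local mu nu t) \<and>
        h (complex_of_real x) = c"
  have "?P (h (of_real x))" using U h loc by blast
  then have "?P (legendreP mu nu x)" unfolding legendreP_def by (rule someI)
  then obtain V g where V: "open V" "complex_of_real ` {1<..} \<subseteq> V" and g: "g holomorphic_on V"
    and gl: "\<And>t. t \<in> {1<..<3} \<Longrightarrow> g (complex_of_real t) = legendreP_local mu nu t"
    and gx: "g (of_real x) = legendreP mu nu x" by blast
  \<comment> \<open>The intersection of the two domains need not be connected; its component through
    2 is, and it contains the whole connected ray.\<close>
  define S where "S = connected_component_set (U \<inter> V) (of_real 2)"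
  have S: "open S" "connected S" "S \<subseteq> U \<inter> V"
    unfolding S_def using U V connected_component_subset[of "U \<inter> V" "of_real 2"]
    by (auto intro!: open_connected_component)
  have ray: "complex_of_real ` {1<..} \<subseteq> S"
    unfolding S_def
  proof (rule connected_component_maximal)
    show "connected (complex_of_real ` {1<..})"
      by (intro connected_continuous_image continuous_intros) auto
    show "complex_of_real 2 \<in> of_real ` {1<..}" by (rule imageI) simp
  qed (use U V in auto)
  have "g (of_real x) - h (of_real x) = 0"
  proof (rule analytic_continuation[where f="\<lambda>z. g z - h z" and S=S and U="of_real ` {1<..<3}" and \<xi>="of_real 2"])
    show "(\<lambda>z. g z - h z) holomorphic_on S"
      using S(3) by (intro holomorphic_intros holomorphic_on_subset[OF g] holomorphic_on_subset[OF h]) auto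
    show "complex_of_real 2 islimpt of_real ` {1<..<3}"
      by (rule islimpt_of_real_open) auto
    show "complex_of_real ` {1<..<3} \<subseteq> S" "complex_of_real 2 \<in> S" "of_real x \<in> S"
      using ray x subsetD[OF ray imageI[of 2 "{1<..}" of_real]] by auto
  qed (use S gl loc in auto)
  then show ?thesis using gx by simp
qed

lemma legendreP_conical:
  assumes mu: "Re mu < 1/2" and n: "n > 0" and t: "t > 1"
  shows "legendreP mu (\<i> * of_real n - 1/2) t =
    cpow ((t + 1) / (t - 1)) (mu / 2) * conical_int mu n (of_real t) / (of_real (sqrt pi) * Gamma (1/2 - mu))"
proof -
  \<comment> \<open>The base is (z + 1)/(z - 1), written so that its real part is visibly positive
    for Re z > 1; hence the principal power is holomorphic there.\<close>
  let ?h = "\<lambda>z. (1 + 2 / (z - 1)) powr (mu / 2) * conical_int mu n z / (of_real (sqrt pi) * Gamma (1/2 - mu))"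
  let ?U = "{z::complex. Re z > 1}"
  have C: "of_real (sqrt pi) * Gamma (1/2 - mu) \<noteq> 0"
  proof -
    have "1/2 - mu \<notin> \<int>\<^sub>\<le>\<^sub>0" using mu by (auto elim!: nonpos_Ints_cases simp: complex_eq_iff)
    then show ?thesis by (simp add: Gamma_eq_zero_iff)
  qed
  have pw: "(1 + 2 / (complex_of_real t - 1)) powr (mu / 2) = cpow ((t + 1) / (t - 1)) (mu / 2)" if "t > 1" for t
  proof -
    have "1 + 2 / (complex_of_real t - 1) = of_real (1 + 2 / (t - 1))" by simp
    also have "1 + 2 / (t - 1) = (t + 1) / (t - 1)" using that by (simp add: field_simps)
    finally show ?thesis using cpow_eq_powr[of "(t + 1) / (t - 1)" "mu / 2"] that by simp
  qed
  have "legendreP mu (\<i> * of_real n - 1/2) t = ?h (of_real t)"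
  proof (rule legendreP_eqI[OF _ _ _ _ _ t])
    show "open ?U" by (rule open_halfspace_Re_gt)
    show "connected ?U" by (intro convex_connected convex_halfspace_Re_gt)
    show "complex_of_real ` {1<..} \<subseteq> ?U" by auto
    have "1 + 2 / (z - 1) \<notin> \<real>\<^sub>\<le>\<^sub>0" if z: "Re z > 1" for z :: complex
    proof -
      have "Re (2 / (z - 1)) = 2 * (Re z - 1) / ((Re z - 1)\<^sup>2 + (Im z)\<^sup>2)" by (simp add: Re_divide)
      also have "\<dots> \<ge> 0" using z by (intro divide_nonneg_nonneg) auto
      finally have "Re (1 + 2 / (z - 1)) > 0" by simp
      then show ?thesis by (rule nonpos_Reals_Re_pos)
    qed
    then show "?h holomorphic_on ?U"
      using C by (intro holomorphic_intros holomorphic_conical_int mu) (auto simp: complex_eq_iff)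
    fix s :: real assume s: "s \<in> {1<..<3}"
    have "- (\<i> * complex_of_real n - 1/2) = 1/2 - \<i> * of_real n" "1 + (\<i> * complex_of_real n - 1/2) = 1/2 + \<i> * of_real n"
      by (auto simp: complex_eq_iff)
    moreover have "complex_of_real ((s + 1) / (s - 1)) powr (mu / 2) = cpow ((s + 1) / (s - 1)) (mu / 2)"
      by (rule cpow_eq_powr) (use s in auto)
    ultimately show "?h (of_real s) = legendreP_local mu (\<i> * of_real n - 1/2) s"
      unfolding legendreP_local_def using C s pw[of s] conical_int_local[OF mu n, of s] by simp
  qed
  then show ?thesis using pw[OF t] by simp
qed

text \<open>The Mehler-Dirichlet formula in the variable y = cosh s - 1.\<close>

lemma legendreP_abel:
  assumes mu: "Re mu < 1/2" and n: "n > 0" and t: "t > 1"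
  shows "cpow (t\<^sup>2 - 1) (- mu / 2) * legendreP mu (\<i> * of_real n - 1/2) t =
    (\<integral>y. indicator {0<..<t - 1} y *\<^sub>R (cpow y (- 1/2) * cpow (t - 1 - y) (- mu - 1/2) * of_real (conical_ker n (y/2))) \<partial>lborel)
      / (of_real (sqrt pi) * Gamma (1/2 - mu))"
proof -
  let ?T = "t - 1"
  have T: "?T > 0" using t by simp
  let ?F = "\<lambda>y. indicator {0<..<t - 1} y *\<^sub>R (cpow y (- 1/2) * cpow (t - 1 - y) (- mu - 1/2) * of_real (conical_ker n (y/2)))"
  have pt: "?F (0 + ?T * r) = (cpow ?T (- 1/2) * cpow ?T (- mu - 1/2)) * (indicator {0<..<1} r *\<^sub>R
     (cpow r (1/2 - 1) * cpow (1 - r) (1/2 - mu - 1) * conical_cker n ((of_real t - 1) / 2 * of_real r)))" for r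
  proof (cases "r \<in> {0<..<1}")
    case True
    have "t - 1 - ?T * r = ?T * (1 - r)" by (simp add: algebra_simps)
    moreover have "cpow (?T * (1 - r)) (- mu - 1/2) = cpow ?T (- mu - 1/2) * cpow (1 - r) (- mu - 1/2)"
      "cpow (?T * r) (- 1/2) = cpow ?T (- 1/2) * cpow r (- 1/2)"
      using T True by (auto intro!: cpow_mult)
    moreover have "0 < ?T * r" "?T * r < ?T" using T True by auto
    moreover have "(complex_of_real t - 1) / 2 * of_real r = of_real (?T * r / 2)" by simp
    moreover have "conical_cker n (of_real (?T * r / 2)) = of_real (conical_ker n (?T * r / 2))"
      by (rule conical_cker_of_real) (use T True in auto)
    moreover have "(1/2 - mu - 1) = - mu - 1/2" "1/2 - 1 = (-1/2 :: complex)" by (auto simp: complex_eq_iff)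
    ultimately show ?thesis using True by (simp only: add_0 greaterThanLessThan_iff indicator_simps) (simp add: indicator_def mult_ac)
  next
    case False
    then have "?T * r \<notin> {0<..<?T}" using T by (auto simp: zero_less_mult_iff)
    then show ?thesis using False by simp
  qed
  have "(\<integral>y. ?F y \<partial>lborel) = \<bar>?T\<bar> *\<^sub>R (\<integral>r. ?F (0 + ?T * r) \<partial>lborel)"
    by (rule lborel_integral_real_affine) (use T in auto)
  also have "\<dots> = of_real ?T * (cpow ?T (- 1/2) * cpow ?T (- mu - 1/2)) * conical_int mu n (of_real t)"
    unfolding pt integral_mult_right_zero conical_int_def[symmetric] using T by (simp add: scaleR_conv_of_real)
  \<comment> \<open>The exponents of T = t - 1, namely 1 from the Jacobian, -1/2 and -mu - 1/2, add
    up to -mu. This power is then split so that the t + 1 factors cancel and the prefactor of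
    \<open>legendreP_conical\<close> appears.\<close>
  also have "of_real ?T * (cpow ?T (- 1/2) * cpow ?T (- mu - 1/2)) = cpow ?T (- mu)"
  proof -
    have "of_real ?T = cpow ?T 1" using T by (simp add: cpow_def exp_of_real)
    then have "of_real ?T * (cpow ?T (- 1/2) * cpow ?T (- mu - 1/2)) = cpow ?T (1 + (- 1/2 + (- mu - 1/2)))"
      by (simp only: cpow_add)
    also have "1 + (- 1/2 + (- mu - 1/2)) = - mu" by (simp add: complex_eq_iff)
    finally show ?thesis .
  qed
  also have "cpow ?T (- mu) = cpow (t\<^sup>2 - 1) (- mu / 2) * cpow ((t + 1) / (t - 1)) (mu / 2)"
  proof -
    have f: "t\<^sup>2 - 1 = (t + 1) * (t - 1)" by (simp add: power2_eq_square algebra_simps)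
    have "cpow (t\<^sup>2 - 1) (- mu / 2) * cpow ((t + 1) / (t - 1)) (mu / 2) =
       (cpow (t + 1) (- mu / 2) * cpow (t - 1) (- mu / 2)) * (cpow (t + 1) (mu / 2) / cpow (t - 1) (mu / 2))"
      unfolding f using t by (simp add: cpow_mult cpow_divide)
    also have "\<dots> = cpow (t - 1) (- mu / 2) * cpow (t - 1) (- mu / 2)"
      using cpow_minus[of "t + 1" "mu/2"] cpow_minus[of "t - 1" "mu/2"] by (simp add: field_simps)
    also have "\<dots> = cpow (t - 1) (- mu)" unfolding cpow_add[symmetric] by simp
    finally show ?thesis ..
  qed
  finally show ?thesis unfolding legendreP_conical[OF mu n t] by simp
qed

section \<open>The Mehler-Fock transform of f\<close>

lemma integrable_pair_mult:
  fixes f g :: "real \<Rightarrow> 'c::{real_normed_field,banach,second_countable_topology}"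
  assumes f: "integrable lborel f" and g: "integrable lborel g"
  shows "integrable (lborel \<Otimes>\<^sub>M lborel) (\<lambda>p. f (fst p) * g (snd p))"
proof (rule lborel_pair.Fubini_integrable)
  have [measurable]: "f \<in> borel_measurable borel" "g \<in> borel_measurable borel"
    using f g by auto
  show "(\<lambda>p. f (fst p) * g (snd p)) \<in> borel_measurable (lborel \<Otimes>\<^sub>M lborel)"
    by measurable
  show "integrable lborel (\<lambda>x. \<integral>y. norm (f (fst (x, y)) * g (snd (x, y))) \<partial>lborel)"
    using f by (simp add: norm_mult)
  show "AE x in lborel. integrable lborel (\<lambda>y. f (fst (x, y)) * g (snd (x, y)))"
    using g by simp
qed

lemma sinh_cosh_measurable [measurable]:
  "(sinh :: real \<Rightarrow> real) \<in> borel_measurable borel" "(cosh :: real \<Rightarrow> real) \<in> borel_measurable borel"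
  by (intro borel_measurable_continuous_onI continuous_intros)+

text \<open>A triple integral in y, u, t: \<open>a\<close> represents the Legendre function,
  \<open>b\<close> represents f. Their product regroups as \<open>c y u * k y u t\<close> with all
  dependence on t in \<open>k\<close>, so integrating t first is elementary and leaves the
  denominator 1 + y + cosh u of \<open>conical_integral\<close>.\<close>

lemma mehler_fock_transform:
  fixes A f :: "real \<Rightarrow> complex"
  assumes mu: "Re mu < 1/2" and n: "n > 0" and A: "continuous_on {0..pi} A"
    and f: "\<And>t. t > 1 \<Longrightarrow> f t = cpow (t\<^sup>2 - 1) (- mu / 2) *
        (LINT u:{0..pi}|lborel. A u * of_real (sinh u) * cpow (t + cosh u) (mu - 3/2))"
  shows "integral {1<..} (\<lambda>t. legendreP mu (\<i> * of_real n - 1/2) t * f t) =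
     of_real (sqrt (2 * pi) / sinh (pi * n)) / Gamma (3/2 - mu) *
       (LINT u:{0..pi}|lborel. A u * of_real (sin (n * u)))"
proof -
  define A0 where "A0 = (\<lambda>u. indicator {0..pi} u *\<^sub>R A u)"
  have A0m [measurable]: "A0 \<in> borel_measurable borel"
    unfolding A0_def by (rule borel_measurable_continuous_on_indicator) (use A in auto)
  let ?C = "complex_of_real (sqrt pi) * Gamma (1/2 - mu)"
  have G: "1/2 - mu \<notin> \<int>\<^sub>\<le>\<^sub>0" using mu by (auto elim!: nonpos_Ints_cases simp: complex_eq_iff)
  define a where "a = (\<lambda>t y. if 0 < y \<and> 1 + y < t
      then cpow y (- 1/2) * cpow (t - (1 + y)) (- mu - 1/2) * of_real (conical_ker n (y/2)) else 0)"
  define b where "b = (\<lambda>t u. A0 u * of_real (sinh u) * cpow (t + cosh u) (mu - 3/2))"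
  define c where "c = (\<lambda>y u. if 0 < y then cpow y (- 1/2) * of_real (conical_ker n (y/2)) * (A0 u * of_real (sinh u)) else 0)"
  define k where "k = (\<lambda>y u t. indicator {1 + y<..} t *\<^sub>R (cpow (t - (1 + y)) (- mu - 1/2) * cpow (t + cosh u) (mu - 3/2)))"
  \<comment> \<open>The condition 1 + y < t is read as a bound on y inside \<open>a\<close> and as a
    bound on t inside \<open>k\<close>; this is the change of the order of integration over the
    triangle.\<close>
  have ab: "a t y * b t u = c y u * k y u t" for t y u
    by (auto simp: a_def b_def c_def k_def indicator_def mult_ac)
  have am [measurable]: "(\<lambda>(t, y). a t y) \<in> borel_measurable (lborel \<Otimes>\<^sub>M lborel)"
    unfolding a_def by measurable
  have bm [measurable]: "(\<lambda>(t, u). b t u) \<in> borel_measurable (lborel \<Otimes>\<^sub>M lborel)"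
    unfolding b_def by measurable
  have cm [measurable]: "(\<lambda>(y, u). c y u) \<in> borel_measurable (lborel \<Otimes>\<^sub>M lborel)"
    unfolding c_def by measurable
  have km: "(\<lambda>(p, t). a t (fst p) * b t (snd p)) \<in> borel_measurable ((lborel \<Otimes>\<^sub>M lborel) \<Otimes>\<^sub>M lborel)"
    unfolding a_def b_def by measurable
  have inta: "(\<integral>y. a t y \<partial>lborel) = ?C * (cpow (t\<^sup>2 - 1) (- mu / 2) * legendreP mu (\<i> * of_real n - 1/2) t)" if "t > 1" for t
  proof -
    have "?C \<noteq> 0" using G by (simp add: Gamma_eq_zero_iff)
    moreover have "(\<integral>y. a t y \<partial>lborel) = (\<integral>y. indicator {0<..<t - 1} y *\<^sub>R (cpow y (- 1/2) * cpow (t - 1 - y) (- mu - 1/2) * of_real (conical_ker n (y/2))) \<partial>lborel)"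
      by (intro Bochner_Integration.integral_cong) (auto simp: a_def indicator_def algebra_simps)
    ultimately show ?thesis unfolding legendreP_abel[OF mu n that] by simp
  qed
  have intb: "(\<integral>u. b t u \<partial>lborel) = (LINT u:{0..pi}|lborel. A u * of_real (sinh u) * cpow (t + cosh u) (mu - 3/2))" for t
    unfolding set_lebesgue_integral_def by (intro Bochner_Integration.integral_cong) (auto simp: b_def A0_def)
  have az: "1 + y + cosh u > 0" if "y > 0" for y u :: real
    using that cosh_real_ge_1[of u] by linarith
  have knorm: "norm (k y u t) = indicator {1 + y<..} t *\<^sub>R ((t - (1 + y)) powr (- Re mu - 1/2) * (t + cosh u) powr (Re mu - 3/2))"
    if "y > 0" for y u t
    using that az[OF that, of u] by (auto simp: k_def indicator_def norm_mult norm_cpow)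
  have intk: "integrable lborel (k y u)" "(\<integral>t. norm (k y u t) \<partial>lborel) = 1 / ((1/2 - Re mu) * (1 + y + cosh u))"
    "(\<integral>t. k y u t \<partial>lborel) = 1 / ((1/2 - mu) * of_real (1 + y + cosh u))" if y: "y > 0" for y u
  proof -
    note R = tail_integral_real[OF az[OF y, of u] mu, unfolded set_integrable_def set_lebesgue_integral_def]
    have m: "k y u \<in> borel_measurable lborel" unfolding k_def by measurable
    have "integrable lborel (\<lambda>t. norm (k y u t))" unfolding knorm[OF y] by (rule R(1))
    then show "integrable lborel (k y u)" using m by (simp add: integrable_norm_iff)
    show "(\<integral>t. norm (k y u t) \<partial>lborel) = 1 / ((1/2 - Re mu) * (1 + y + cosh u))"
      unfolding knorm[OF y] by (rule R(2))
    show "(\<integral>t. k y u t \<partial>lborel) = 1 / ((1/2 - mu) * of_real (1 + y + cosh u))"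
      unfolding k_def by (rule tail_integral_complex[OF az[OF y, of u] mu, unfolded set_lebesgue_integral_def])
  qed
  \<comment> \<open>The variables are grouped as the plane (y, u) and the line t, so that a single
    exchange brings the t-integral inside.\<close>
  interpret T: pair_sigma_finite "lborel \<Otimes>\<^sub>M lborel :: (real \<times> real) measure" "lborel :: real measure"
    by (simp add: pair_sigma_finite_def lborel_prod lborel.sigma_finite_measure_axioms)
  let ?K = "\<lambda>p t. a t (fst p) * b t (snd p)"
  have int: "integrable ((lborel \<Otimes>\<^sub>M lborel) \<Otimes>\<^sub>M lborel) (case_prod ?K)"
  proof (rule T.Fubini_integrable)
    show "case_prod ?K \<in> borel_measurable ((lborel \<Otimes>\<^sub>M lborel) \<Otimes>\<^sub>M lborel)"
      by (rule km)
    have n1: "(\<integral>t. norm (case_prod ?K (p, t)) \<partial>lborel) = norm (c (fst p) (snd p)) / ((1/2 - Re mu) * (1 + fst p + cosh (snd p)))" for p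
    proof (cases "fst p > 0")
      case True
      then show ?thesis using intk(2)[OF True, of "snd p"] by (simp add: ab norm_mult)
    next
      case False
      then show ?thesis by (simp add: ab c_def)
    qed
    show "AE p in lborel \<Otimes>\<^sub>M lborel. integrable lborel (\<lambda>t. case_prod ?K (p, t))"
    proof (rule AE_I2)
      fix p :: "real \<times> real"
      show "integrable lborel (\<lambda>t. case_prod ?K (p, t))"
        using intk(1)[of "fst p" "snd p"] by (cases "fst p > 0") (simp_all add: ab c_def)
    qed
    \<comment> \<open>The bound 1 + y + cosh u >= 1 + y decouples the variables: the majorant is a
      product of the integrable weight in y and a function of u supported on [0, pi].\<close>
    let ?w = "\<lambda>p. (indicator {0<..} (fst p) *\<^sub>R (fst p powr (-1/2) / (1 + fst p))) * (norm (A0 (snd p) * of_real (sinh (snd p))) / (1/2 - Re mu))"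
    have "integrable lborel (\<lambda>u. indicator {0..pi} u *\<^sub>R (A u * complex_of_real (sinh u)))"
      by (intro borel_integrable_compact continuous_intros A) auto
    then have "integrable lborel (\<lambda>u. norm (A0 u * of_real (sinh u)))"
      by (intro integrable_norm) (simp add: A0_def)
    then have w: "integrable (lborel \<Otimes>\<^sub>M lborel) ?w"
      using set_integrable_inverse_sqrt_weight[unfolded set_integrable_def]
      by (intro integrable_pair_mult) auto
    show "integrable (lborel \<Otimes>\<^sub>M lborel) (\<lambda>p. \<integral>t. norm (case_prod ?K (p, t)) \<partial>lborel)"
      unfolding n1
    proof (rule Bochner_Integration.integrable_bound[OF w])
      show "(\<lambda>p. norm (c (fst p) (snd p)) / ((1/2 - Re mu) * (1 + fst p + cosh (snd p)))) \<in> borel_measurable (lborel \<Otimes>\<^sub>M lborel)"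
        unfolding c_def by measurable
      show "AE p in lborel \<Otimes>\<^sub>M lborel. norm (norm (c (fst p) (snd p)) / ((1/2 - Re mu) * (1 + fst p + cosh (snd p)))) \<le> norm (?w p)"
      proof (rule AE_I2)
        fix p :: "real \<times> real"
        obtain y u where p: "p = (y, u)" by (cases p)
        show "norm (norm (c (fst p) (snd p)) / ((1/2 - Re mu) * (1 + fst p + cosh (snd p)))) \<le> norm (?w p)"
        proof (cases "y > 0")
          case True
          let ?N = "norm (A0 u * of_real (sinh u))"
          have m: "1/2 - Re mu > 0" using mu by simp
          have "norm (cpow y (- 1/2)) = y powr (-1/2)" using norm_cpow[OF True, of "-1/2"] by simp
          then have "norm (c y u) = y powr (-1/2) * \<bar>conical_ker n (y/2)\<bar> * ?N"
            using True by (simp add: c_def norm_mult)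
          also have "\<dots> \<le> y powr (-1/2) * 1 * ?N"
            using abs_conical_ker_le_1[of "y/2" n] True by (intro mult_right_mono mult_left_mono) auto
          finally have 1: "norm (c y u) \<le> y powr (-1/2) * ?N" by simp
          have "norm (c y u) / ((1/2 - Re mu) * (1 + y + cosh u)) \<le> y powr (-1/2) * ?N / ((1/2 - Re mu) * (1 + y))"
            using 1 m True cosh_real_ge_1[of u] by (intro frac_le mult_left_mono mult_pos_pos) auto
          also have "\<dots> = ?w p" using True by (simp add: p)
          finally have "norm (c y u) / ((1/2 - Re mu) * (1 + y + cosh u)) \<le> ?w p" .
          moreover have "norm (c y u) / ((1/2 - Re mu) * (1 + y + cosh u)) \<ge> 0"
            using m az[OF True, of u] by (intro divide_nonneg_nonneg mult_nonneg_nonneg) auto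
          ultimately show ?thesis by (simp only: p fst_conv snd_conv real_norm_def)
        qed (simp add: p c_def)
      qed
    qed
  qed
  have fin: "integrable lborel (\<lambda>t. \<integral>p. ?K p t \<partial>(lborel \<Otimes>\<^sub>M lborel))"
    by (rule T.integrable_snd[OF int])
  \<comment> \<open>Fubini guarantees integrability in (y, u) only for almost every t; for those t
    the double integral factors.\<close>
  have slice: "AE t in lborel. (\<integral>p. ?K p t \<partial>(lborel \<Otimes>\<^sub>M lborel)) = (\<integral>y. a t y \<partial>lborel) * (\<integral>u. b t u \<partial>lborel)"
    using T.AE_integrable_snd[OF int]
  proof eventually_elim
    case (elim t)
    have "(\<integral>p. ?K p t \<partial>(lborel \<Otimes>\<^sub>M lborel)) = (\<integral>y. (\<integral>u. a t y * b t u \<partial>lborel) \<partial>lborel)"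
      using lborel_pair.integral_fst[of "\<lambda>y u. a t y * b t u"] elim by (simp add: case_prod_unfold)
    also have "\<dots> = (\<integral>y. a t y \<partial>lborel) * (\<integral>u. b t u \<partial>lborel)"
      by simp
    finally show ?case .
  qed
  \<comment> \<open>For t <= 1 no y satisfies 0 < y and 1 + y < t, so \<open>a t\<close> is zero and
    both sides vanish.\<close>
  have eq: "indicator {1<..} t *\<^sub>R (legendreP mu (\<i> * of_real n - 1/2) t * f t) =
      (\<integral>y. a t y \<partial>lborel) * (\<integral>u. b t u \<partial>lborel) / ?C" for t
  proof (cases "t > 1")
    case True
    have "?C \<noteq> 0" using G by (simp add: Gamma_eq_zero_iff)
    then show ?thesis using True by (simp add: inta intb f mult_ac)
  next
    case False
    then have "a t = (\<lambda>y. 0)" by (auto simp: a_def)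
    then show ?thesis using False by simp
  qed
  have meas: "(\<lambda>t. (\<integral>y. a t y \<partial>lborel) * (\<integral>u. b t u \<partial>lborel)) \<in> borel_measurable lborel"
    by measurable
  have fin': "integrable lborel (\<lambda>t. (\<integral>y. a t y \<partial>lborel) * (\<integral>u. b t u \<partial>lborel))"
    using fin by (rule integrable_cong_AE_imp[OF _ meas]) (use slice in auto)
  have si: "set_integrable lborel {1<..} (\<lambda>t. legendreP mu (\<i> * of_real n - 1/2) t * f t)"
    unfolding set_integrable_def eq using fin' by simp
  have "integral {1<..} (\<lambda>t. legendreP mu (\<i> * of_real n - 1/2) t * f t) =
      (\<integral>t. (\<integral>y. a t y \<partial>lborel) * (\<integral>u. b t u \<partial>lborel) / ?C \<partial>lborel)"
    unfolding set_borel_integral_eq_integral(2)[OF si, symmetric] set_lebesgue_integral_def eq ..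
  also have "\<dots> = (\<integral>t. (\<integral>p. ?K p t \<partial>(lborel \<Otimes>\<^sub>M lborel)) \<partial>lborel) / ?C"
    by (subst integral_divide_zero, rule arg_cong[where f="\<lambda>x. x / ?C"], rule integral_cong_AE)
       (use slice fin fin' in auto)
  also have "(\<integral>t. (\<integral>p. ?K p t \<partial>(lborel \<Otimes>\<^sub>M lborel)) \<partial>lborel) = (\<integral>p. (\<integral>t. ?K p t \<partial>lborel) \<partial>(lborel \<Otimes>\<^sub>M lborel))"
    using T.integral_snd[OF int] T.integral_fst[OF int] by simp
  also have "\<dots> = (\<integral>u. (\<integral>y. (\<integral>t. a t y * b t u \<partial>lborel) \<partial>lborel) \<partial>lborel)"
    using lborel_pair.integral_snd[of "\<lambda>y u. \<integral>t. a t y * b t u \<partial>lborel"] T.integrable_fst[OF int]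
    by (simp add: case_prod_unfold)
  also have "\<dots> = (\<integral>u. of_real (sqrt 2 * pi / sinh (pi * n)) / (1/2 - mu) * (indicator {0..pi} u *\<^sub>R (A u * of_real (sin (n * u)))) \<partial>lborel)"
  proof (intro Bochner_Integration.integral_cong refl)
    fix u :: real
    let ?g = "\<lambda>y. y powr (-1/2) * conical_ker n (y/2) / (1 + y + cosh u)"
    have inner: "(\<integral>t. a t y * b t u \<partial>lborel) = (A0 u * of_real (sinh u) / (1/2 - mu)) * of_real (indicator {0<..} y *\<^sub>R ?g y)" for y
    proof (cases "y > 0")
      case True
      have "(\<integral>t. a t y * b t u \<partial>lborel) = c y u * (1 / ((1/2 - mu) * of_real (1 + y + cosh u)))"
        by (simp only: ab integral_mult_right_zero intk(3)[OF True])
      also have "c y u = of_real (y powr (-1/2) * conical_ker n (y/2)) * (A0 u * of_real (sinh u))"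
        using True cpow_of_real[OF True, of "-1/2"] by (simp add: c_def)
      finally show ?thesis using True by simp
    qed (simp add: ab c_def)
    have "(\<integral>y. (\<integral>t. a t y * b t u \<partial>lborel) \<partial>lborel) =
        (A0 u * of_real (sinh u) / (1/2 - mu)) * of_real (LINT y:{0<..}|lborel. ?g y)"
      unfolding inner set_lebesgue_integral_def by (simp only: integral_mult_right_zero integral_complex_of_real)
    also have "\<dots> = A0 u / (1/2 - mu) * of_real (sinh u * (LINT y:{0<..}|lborel. ?g y))"
      by simp
    also have "\<dots> = of_real (sqrt 2 * pi / sinh (pi * n)) / (1/2 - mu) * (indicator {0..pi} u *\<^sub>R (A u * of_real (sin (n * u))))"
    proof (cases "u \<in> {0..pi}")
      case True
      then show ?thesis using conical_integral[OF n, of u] by (simp add: A0_def mult_ac)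
    qed (simp add: A0_def)
    finally show "(\<integral>y. (\<integral>t. a t y * b t u \<partial>lborel) \<partial>lborel) =
      of_real (sqrt 2 * pi / sinh (pi * n)) / (1/2 - mu) * (indicator {0..pi} u *\<^sub>R (A u * of_real (sin (n * u))))" .
  qed
  also have "\<dots> = of_real (sqrt 2 * pi / sinh (pi * n)) / (1/2 - mu) * (LINT u:{0..pi}|lborel. A u * of_real (sin (n * u)))"
    unfolding set_lebesgue_integral_def by (rule integral_mult_right_zero)
  finally have "integral {1<..} (\<lambda>t. legendreP mu (\<i> * of_real n - 1/2) t * f t) =
     of_real (sqrt 2 * pi / sinh (pi * n)) / (1/2 - mu) * (LINT u:{0..pi}|lborel. A u * of_real (sin (n * u))) / ?C" .
  \<comment> \<open>The factor 1/2 - mu from the t-integral and Gamma(1/2 - mu) from the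
    Mehler-Dirichlet constant merge here; next, pi / sqrt pi turns the numerical factor into sqrt (2
    pi).\<close>
  moreover have "Gamma (3/2 - mu) = (1/2 - mu) * Gamma (1/2 - mu)"
  proof -
    have "3/2 - mu = 1/2 - mu + 1" by (simp add: complex_eq_iff)
    then show ?thesis using Gamma_plus1[OF G] by simp
  qed
  moreover have "complex_of_real (sqrt (2 * pi) / sinh (pi * n)) = of_real (sqrt 2 * pi / sinh (pi * n)) / of_real (sqrt pi)"
  proof -
    have "sqrt (2 * pi) / sinh (pi * n) = sqrt 2 * pi / sinh (pi * n) / sqrt pi"
    proof -
      have "sqrt 2 * pi / sinh (pi * n) / sqrt pi = sqrt 2 * (pi / sqrt pi) / sinh (pi * n)" by simp
      also have "pi / sqrt pi = sqrt pi" by (simp add: real_div_sqrt)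
      finally show ?thesis by (simp add: real_sqrt_mult)
    qed
    then show ?thesis by (simp only: of_real_divide)
  qed
  moreover have "s / h * L / (p * g) = s / p / (h * g) * L" for s h L p g :: complex
    by (simp add: mult_ac)
  ultimately show ?thesis by (simp only:)
qed

section \<open>The Parseval identity for cosine series\<close>

definition cos_coeff :: "(real \<Rightarrow> real) \<Rightarrow> nat \<Rightarrow> real" where
  "cos_coeff F n = integral {0..pi} (\<lambda>x. F x * cos (real n * x))"

text \<open>The reciprocal of the squared norm of cos(nx) in L2(0, pi), which is pi for n = 0 and
  pi/2 otherwise.\<close>

definition cos_weight :: "nat \<Rightarrow> real" where
  "cos_weight n = (if n = 0 then 1 / pi else 2 / pi)"

lemma integral_cos_int:
  fixes k :: int
  shows "integral {0..pi} (\<lambda>x. cos (of_int k * x)) = (if k = 0 then pi else 0)"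
proof (cases "k = 0")
  case False
  have "((\<lambda>x. cos (of_int k * x)) has_integral (sin (of_int k * pi) / of_int k - sin (of_int k * 0) / of_int k)) {0..pi}"
  proof (rule fundamental_theorem_of_calculus)
    show "((\<lambda>x. sin (of_int k * x) / of_int k) has_vector_derivative cos (of_int k * x)) (at x within {0..pi})" for x
      using False unfolding has_real_derivative_iff_has_vector_derivative[symmetric]
      by (auto intro!: derivative_eq_intros)
  qed simp
  moreover have "sin (of_int k * pi) = 0" by (simp add: sin_zero_iff_int2)
  ultimately show ?thesis using False by (simp add: integral_unique)
qed simp

lemma cos_coeff_cos: "cos_coeff (\<lambda>x. cos (real m * x)) n = (if m = n then 1 / cos_weight n else 0)"
proof -
  have e: "cos (real m * x) * cos (real n * x) =
      (cos (of_int (int m - int n) * x) + cos (of_int (int m + int n) * x)) / 2" for x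
    by (simp add: cos_times_cos algebra_simps)
  have "cos_coeff (\<lambda>x. cos (real m * x)) n =
      (integral {0..pi} (\<lambda>x. cos (of_int (int m - int n) * x)) + integral {0..pi} (\<lambda>x. cos (of_int (int m + int n) * x))) / 2"
    unfolding cos_coeff_def e
    by (subst Henstock_Kurzweil_Integration.integral_divide,
        subst Henstock_Kurzweil_Integration.integral_add)
       (auto intro!: integrable_continuous_real continuous_intros)
  then show ?thesis unfolding integral_cos_int by (auto simp: cos_weight_def)
qed

abbreviation continuous_0_pi :: "(real \<Rightarrow> real) \<Rightarrow> bool" where "continuous_0_pi F \<equiv> continuous_on {0..pi} F"

lemma cos_coeff_add: "continuous_0_pi F \<Longrightarrow> continuous_0_pi G \<Longrightarrow> cos_coeff (\<lambda>x. F x + G x) n = cos_coeff F n + cos_coeff G n"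
  unfolding cos_coeff_def distrib_right
  by (intro Henstock_Kurzweil_Integration.integral_add integrable_continuous_real continuous_intros)

lemma cos_coeff_cmult: "cos_coeff (\<lambda>x. c * F x) n = c * cos_coeff F n"
  unfolding cos_coeff_def by (simp add: mult.assoc)

text \<open>As a symmetric bilinear form on continuous functions the defect is positive semidefinite
  (Bessel) and annihilates cosine polynomials of degree below N.\<close>

definition parseval_defect :: "nat \<Rightarrow> (real \<Rightarrow> real) \<Rightarrow> (real \<Rightarrow> real) \<Rightarrow> real" where
  "parseval_defect N F G = integral {0..pi} (\<lambda>x. F x * G x) - (\<Sum>n<N. cos_weight n * cos_coeff F n * cos_coeff G n)"

lemma parseval_defect_commute: "parseval_defect N F G = parseval_defect N G F"
  by (simp add: parseval_defect_def mult_ac)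

lemma parseval_defect_add_left: "continuous_0_pi F \<Longrightarrow> continuous_0_pi G \<Longrightarrow> continuous_0_pi H \<Longrightarrow> parseval_defect N (\<lambda>x. F x + G x) H = parseval_defect N F H + parseval_defect N G H"
  unfolding parseval_defect_def
  by (simp add: cos_coeff_add distrib_right distrib_left sum.distrib Henstock_Kurzweil_Integration.integral_add
      integrable_continuous_real continuous_intros)

lemma parseval_defect_cmult_left: "parseval_defect N (\<lambda>x. c * F x) H = c * parseval_defect N F H"
  unfolding parseval_defect_def by (simp add: cos_coeff_cmult sum_distrib_left mult.assoc right_diff_distrib mult.left_commute)

text \<open>Bessel's argument: with S the weighted partial cosine sum of H, orthogonality makes the
  integral of S^2 equal to that of H S, so the defect is the integral of (H - S)^2.\<close>

lemma parseval_defect_nonneg: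
  assumes H: "continuous_0_pi H"
  shows "parseval_defect N H H \<ge> 0"
proof -
  define S where "S = (\<lambda>x. \<Sum>n<N. (cos_weight n * cos_coeff H n) * cos (real n * x))"
  have cS: "continuous_0_pi S" unfolding S_def by (intro continuous_intros)
  have IS: "integral {0..pi} (\<lambda>x. F x * S x) = (\<Sum>n<N. cos_weight n * cos_coeff H n * cos_coeff F n)" if F: "continuous_0_pi F" for F
  proof -
    have "integral {0..pi} (\<lambda>x. F x * S x) = integral {0..pi} (\<lambda>x. \<Sum>n<N. (cos_weight n * cos_coeff H n) * (F x * cos (real n * x)))"
      unfolding S_def by (simp add: sum_distrib_left mult_ac)
    also have "\<dots> = (\<Sum>n<N. integral {0..pi} (\<lambda>x. (cos_weight n * cos_coeff H n) * (F x * cos (real n * x))))"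
      by (rule Henstock_Kurzweil_Integration.integral_sum)
         (use F in \<open>auto intro!: integrable_continuous_real continuous_intros\<close>)
    also have "\<dots> = (\<Sum>n<N. cos_weight n * cos_coeff H n * cos_coeff F n)"
      unfolding cos_coeff_def by simp
    finally show ?thesis .
  qed
  have cS': "cos_coeff S m = cos_coeff H m" if "m < N" for m
  proof -
    have "cos_coeff S m = (\<Sum>n<N. cos_weight n * cos_coeff H n * cos_coeff (\<lambda>x. cos (real m * x)) n)"
      using IS[of "\<lambda>x. cos (real m * x)"] unfolding cos_coeff_def by (simp add: mult.commute continuous_intros)
    also have "\<dots> = (\<Sum>n<N. if n = m then cos_coeff H m else 0)"
      unfolding cos_coeff_cos by (intro sum.cong) (auto simp: cos_weight_def)
    finally show ?thesis using that by simp
  qed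
  have "0 \<le> integral {0..pi} (\<lambda>x. (H x - S x)\<^sup>2)"
    by (rule integral_nonneg) (use H cS in \<open>auto intro!: integrable_continuous_real continuous_intros\<close>)
  also have "(\<lambda>x. (H x - S x)\<^sup>2) = (\<lambda>x. (H x * H x - 2 * (H x * S x)) + S x * S x)"
    by (simp add: fun_eq_iff power2_eq_square algebra_simps)
  also have "integral {0..pi} \<dots> = integral {0..pi} (\<lambda>x. H x * H x) - 2 * integral {0..pi} (\<lambda>x. H x * S x) + integral {0..pi} (\<lambda>x. S x * S x)"
    using H cS
    by (subst Henstock_Kurzweil_Integration.integral_add, (auto intro!: integrable_continuous_real continuous_intros)[2],
        subst Henstock_Kurzweil_Integration.integral_diff, (auto intro!: integrable_continuous_real continuous_intros)[2]) simp
  also have "integral {0..pi} (\<lambda>x. S x * S x) = integral {0..pi} (\<lambda>x. H x * S x)"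
    unfolding IS[OF H] IS[OF cS] by (intro sum.cong) (auto simp: cS')
  finally show ?thesis using IS[OF H] by (simp add: parseval_defect_def)
qed

lemma parseval_defect_le: "parseval_defect N H H \<le> integral {0..pi} (\<lambda>x. H x * H x)"
proof -
  have "(\<Sum>n<N. cos_weight n * cos_coeff H n * cos_coeff H n) \<ge> 0"
    unfolding mult.assoc by (intro sum_nonneg mult_nonneg_nonneg zero_le_square) (auto simp: cos_weight_def)
  then show ?thesis by (simp add: parseval_defect_def)
qed

text \<open>Cauchy-Schwarz for the semidefinite form, obtained from its values at R + d G and R - d
  G. With the multiplier of G equal to the sup bound d, one factor d cancels; the result is linear
  in d and independent of N.\<close>

lemma parseval_defect_bound:
  assumes R: "continuous_0_pi R" and G: "continuous_0_pi G" and d: "d > 0" and Rd: "\<And>x. x \<in> {0..pi} \<Longrightarrow> \<bar>R x\<bar> \<le> d"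
  shows "2 * \<bar>parseval_defect N R G\<bar> \<le> d * (pi + integral {0..pi} (\<lambda>x. G x * G x))"
proof -
  let ?I = "integral {0..pi} (\<lambda>x. G x * G x)"
  have RR: "parseval_defect N R R \<le> d * d * pi"
  proof -
    have "parseval_defect N R R \<le> integral {0..pi} (\<lambda>x. R x * R x)" by (rule parseval_defect_le)
    also have "\<dots> \<le> integral {0..pi} (\<lambda>x. d * d)"
    proof (rule integral_le)
      show "R x * R x \<le> d * d" if "x \<in> {0..pi}" for x
        using Rd[OF that] d mult_mono[of "\<bar>R x\<bar>" d "\<bar>R x\<bar>" d] by simp
    qed (use R in \<open>auto intro!: integrable_continuous_real continuous_intros\<close>)
    finally show ?thesis by (simp add: mult_ac)
  qed
  have key: "0 \<le> d * d * pi + 2 * c * parseval_defect N R G + c * c * ?I" for c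
  proof -
    have cG: "continuous_0_pi (\<lambda>x. c * G x)" by (intro continuous_intros G)
    have cs: "continuous_0_pi (\<lambda>x. R x + c * G x)" by (intro continuous_intros G R)
    have "0 \<le> parseval_defect N (\<lambda>x. R x + c * G x) (\<lambda>x. R x + c * G x)" by (rule parseval_defect_nonneg[OF cs])
    also have "\<dots> = parseval_defect N R (\<lambda>x. R x + c * G x) + c * parseval_defect N G (\<lambda>x. R x + c * G x)"
      by (simp only: parseval_defect_add_left[OF R cG cs] parseval_defect_cmult_left)
    also have "parseval_defect N R (\<lambda>x. R x + c * G x) = parseval_defect N R R + c * parseval_defect N G R"
      by (simp only: parseval_defect_commute[of N R "\<lambda>x. R x + c * G x"] parseval_defect_add_left[OF R cG R] parseval_defect_cmult_left)
    also have "parseval_defect N G (\<lambda>x. R x + c * G x) = parseval_defect N R G + c * parseval_defect N G G"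
      by (simp only: parseval_defect_commute[of N G "\<lambda>x. R x + c * G x"] parseval_defect_add_left[OF R cG G] parseval_defect_cmult_left)
    also have "parseval_defect N R R + c * parseval_defect N G R + c * (parseval_defect N R G + c * parseval_defect N G G) = parseval_defect N R R + 2 * c * parseval_defect N R G + c * c * parseval_defect N G G"
      by (simp add: parseval_defect_commute[of N G R] algebra_simps)
    also have "\<dots> \<le> d * d * pi + 2 * c * parseval_defect N R G + c * c * ?I"
      by (intro add_mono RR order_refl mult_left_mono parseval_defect_le zero_le_square)
    finally show ?thesis .
  qed
  have "0 \<le> d * (d * pi + 2 * parseval_defect N R G + d * ?I)" using key[of d] by (simp add: algebra_simps)
  then have 1: "0 \<le> d * pi + 2 * parseval_defect N R G + d * ?I" using d by (simp add: zero_le_mult_iff)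
  have "0 \<le> d * (d * pi - 2 * parseval_defect N R G + d * ?I)" using key[of "-d"] by (simp add: algebra_simps)
  then have 2: "0 \<le> d * pi - 2 * parseval_defect N R G + d * ?I" using d by (simp add: zero_le_mult_iff)
  show ?thesis using 1 2 by (simp add: algebra_simps abs_le_iff)
qed

section \<open>Cosine polynomials and the density argument\<close>

definition parseval_exact :: "(real \<Rightarrow> real) \<Rightarrow> bool" where
  "parseval_exact T \<longleftrightarrow> continuous_0_pi T \<and> (\<exists>M. \<forall>N\<ge>M. \<forall>G. continuous_0_pi G \<longrightarrow> parseval_defect N T G = 0)"

lemma parseval_exact_cos: "parseval_exact (\<lambda>x. cos (real m * x))"
  unfolding parseval_exact_def
proof (intro conjI exI[of _ "Suc m"] allI impI)
  fix N G assume N: "Suc m \<le> N" and G: "continuous_0_pi G"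
  have "(\<Sum>n<N. cos_weight n * cos_coeff (\<lambda>x. cos (real m * x)) n * cos_coeff G n) = (\<Sum>n<N. if n = m then cos_coeff G m else 0)"
    unfolding cos_coeff_cos by (intro sum.cong) (auto simp: cos_weight_def)
  also have "\<dots> = cos_coeff G m" using N by simp
  finally show "parseval_defect N (\<lambda>x. cos (real m * x)) G = 0"
    by (simp add: parseval_defect_def cos_coeff_def mult.commute)
qed (intro continuous_intros)

lemma parseval_exact_lin:
  assumes "parseval_exact S" "parseval_exact T"
  shows "parseval_exact (\<lambda>x. c * S x + d * T x)"
proof -
  obtain M1 M2 where S: "continuous_0_pi S" and M1: "\<And>N G. N \<ge> M1 \<Longrightarrow> continuous_0_pi G \<Longrightarrow> parseval_defect N S G = 0"
    and T: "continuous_0_pi T" and M2: "\<And>N G. N \<ge> M2 \<Longrightarrow> continuous_0_pi G \<Longrightarrow> parseval_defect N T G = 0"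
    using assms unfolding parseval_exact_def by blast
  have c: "continuous_0_pi (\<lambda>x. c * S x)" "continuous_0_pi (\<lambda>x. d * T x)" by (intro continuous_intros S T)+
  have "parseval_defect N (\<lambda>x. c * S x + d * T x) G = 0" if "N \<ge> max M1 M2" "continuous_0_pi G" for N G
    using that by (simp add: parseval_defect_add_left[OF c] parseval_defect_cmult_left M1 M2)
  moreover have "continuous_0_pi (\<lambda>x. c * S x + d * T x)" by (intro continuous_intros S T)
  ultimately show ?thesis unfolding parseval_exact_def by blast
qed

text \<open>Bridges orthogonality, which concerns cos(mx), and Weierstrass approximation, which
  yields powers of cos x. The additional factor cos(mx) makes the induction close: cos x cos(mx) is
  the mean of cos((m+1)x) and cos((m-1)x), with m = 0 treated apart.\<close>

lemma parseval_exact_cos_power: "parseval_exact (\<lambda>x. cos x ^ k * cos (real m * x))"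
proof (induction k arbitrary: m)
  case 0
  then show ?case using parseval_exact_cos by simp
next
  case (Suc k)
  show ?case
  proof (cases m)
    case 0
    then show ?thesis using Suc.IH[of 1] by (simp add: mult.commute)
  next
    case (Suc j)
    have "cos x ^ Suc k * cos (real m * x) =
        1/2 * (cos x ^ k * cos (real (Suc m) * x)) + 1/2 * (cos x ^ k * cos (real j * x))" for x
    proof -
      have "cos x * cos (real m * x) = (cos (real (Suc m) * x) + cos (real j * x)) / 2"
        unfolding Suc by (subst mult.commute) (simp add: cos_times_cos algebra_simps)
      then have "cos x ^ k * (cos x * cos (real m * x)) = cos x ^ k * ((cos (real (Suc m) * x) + cos (real j * x)) / 2)"
        by (simp only:)
      then show ?thesis by (simp add: field_simps del: of_nat_Suc)
    qed
    then show ?thesis using parseval_exact_lin[OF Suc.IH[of "Suc m"] Suc.IH[of j], of "1/2" "1/2"] by simp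
  qed
qed

lemma parseval_exact_cos_poly: "parseval_exact (\<lambda>x. \<Sum>i\<le>(k::nat). a i * cos x ^ i)"
proof (induction k)
  case 0
  then show ?case
    using parseval_exact_lin[OF parseval_exact_cos[of 0] parseval_exact_cos[of 0], of "a 0" 0] by simp
next
  case (Suc k)
  show ?case
    using parseval_exact_lin[OF Suc parseval_exact_cos_power[of "Suc k" 0], of 1 "a (Suc k)"] by simp
qed

text \<open>F is transported to [-1, 1] by arccos and approximated there by a polynomial, so F is
  uniformly close to a polynomial T in cos x. The defect of T vanishes for large N, and that of F -
  T is small uniformly in N.\<close>

theorem cosine_Parseval_real:
  assumes F: "continuous_0_pi F" and G: "continuous_0_pi G"
  shows "(\<lambda>n. cos_weight n * cos_coeff F n * cos_coeff G n) sums integral {0..pi} (\<lambda>x. F x * G x)"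
proof -
  let ?I = "integral {0..pi} (\<lambda>x. G x * G x)"
  have I0: "?I \<ge> 0"
    by (rule integral_nonneg) (use G in \<open>auto intro!: integrable_continuous_real continuous_intros\<close>)
  have "(\<lambda>N. parseval_defect N F G) \<longlonglongrightarrow> 0"
  proof (rule LIMSEQ_I)
    fix e :: real assume e: "e > 0"
    \<comment> \<open>Chosen so that \<open>parseval_defect_bound\<close> bounds twice the defect by
      e; the factor 2 leaves strict inequality.\<close>
    define d where "d = e / (pi + ?I)"
    have pI: "pi + ?I > 0" using I0 pi_gt_zero by linarith
    have d: "d > 0" using e pI by (simp add: d_def)
    have "continuous_on {-1..1} (\<lambda>y. F (arccos y))"
    proof (rule continuous_on_compose2[OF F])
      show "continuous_on {-1..1} arccos" by (rule continuous_on_arccos')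
    qed (auto simp: arccos_lbound arccos_ubound)
    then obtain g where g: "real_polynomial_function g" "\<And>y. y \<in> {-1..1} \<Longrightarrow> \<bar>F (arccos y) - g y\<bar> < d"
      using Stone_Weierstrass_real_polynomial_function[of "{-1..1}" "\<lambda>y. F (arccos y)" d] d by auto
    then obtain a k where ak: "g = (\<lambda>x. \<Sum>i\<le>(k::nat). a i * x ^ i)"
      unfolding real_polynomial_function_iff_sum by blast
    define T where "T = (\<lambda>x. g (cos x))"
    have "parseval_exact T" unfolding T_def ak by (rule parseval_exact_cos_poly)
    then obtain M where T: "continuous_0_pi T" and M: "\<And>N G. N \<ge> M \<Longrightarrow> continuous_0_pi G \<Longrightarrow> parseval_defect N T G = 0"
      unfolding parseval_exact_def by blast
    have R: "continuous_0_pi (\<lambda>x. F x - T x)" by (intro continuous_intros F T)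
    have Rd: "\<bar>F x - T x\<bar> \<le> d" if "x \<in> {0..pi}" for x
      using g(2)[of "cos x"] that by (simp add: T_def arccos_cos less_imp_le)
    have "norm (parseval_defect N F G - 0) < e" if "N \<ge> M" for N
    proof -
      have "parseval_defect N F G = parseval_defect N (\<lambda>x. (F x - T x) + T x) G" by simp
      also have "\<dots> = parseval_defect N (\<lambda>x. F x - T x) G" by (simp only: parseval_defect_add_left[OF R T G] M[OF that G] add_0_right)
      finally have "2 * \<bar>parseval_defect N F G\<bar> \<le> d * (pi + ?I)" using parseval_defect_bound[OF R G d Rd] by simp
      also have "\<dots> = e" using pI by (simp add: d_def)
      finally show ?thesis using e by simp
    qed
    then show "\<exists>M. \<forall>N\<ge>M. norm (parseval_defect N F G - 0) < e" by blast
  qed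
  then have "(\<lambda>N. integral {0..pi} (\<lambda>x. F x * G x) - parseval_defect N F G) \<longlonglongrightarrow> integral {0..pi} (\<lambda>x. F x * G x) - 0"
    by (intro tendsto_intros)
  then show ?thesis by (simp add: sums_def parseval_defect_def)
qed

text \<open>The pairing is bilinear, without conjugation, as the product A' times a complex power
  demands. Real and imaginary parts give four instances of the real theorem.\<close>

theorem cosine_Parseval_complex:
  fixes F G :: "real \<Rightarrow> complex"
  assumes F: "continuous_on {0..pi} F" and G: "continuous_on {0..pi} G"
  shows "(\<lambda>n. of_real (cos_weight n) * integral {0..pi} (\<lambda>x. F x * of_real (cos (real n * x))) *
            integral {0..pi} (\<lambda>x. G x * of_real (cos (real n * x)))) sums integral {0..pi} (\<lambda>x. F x * G x)"
proof -
  let ?F1 = "\<lambda>x. Re (F x)" and ?F2 = "\<lambda>x. Im (F x)" and ?G1 = "\<lambda>x. Re (G x)" and ?G2 = "\<lambda>x. Im (G x)"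
  let ?I = "\<lambda>f. integral {0..pi} f"
  have split: "?I H = of_real (?I (\<lambda>x. Re (H x))) + \<i> * of_real (?I (\<lambda>x. Im (H x)))"
    if H: "continuous_on {0..pi} H" for H :: "real \<Rightarrow> complex"
  proof -
    have i: "H integrable_on {0..pi}" by (rule integrable_continuous_real[OF H])
    have "?I (\<lambda>x. Re (H x)) = Re (?I H)" "?I (\<lambda>x. Im (H x)) = Im (?I H)"
      using integral_linear[OF i bounded_linear_Re] integral_linear[OF i bounded_linear_Im] by (auto simp: comp_def)
    then show ?thesis by (simp add: complex_eq_iff)
  qed
  have c: "continuous_0_pi ?F1" "continuous_0_pi ?F2" "continuous_0_pi ?G1" "continuous_0_pi ?G2" by (intro continuous_intros F G)+
  have cF: "?I (\<lambda>x. F x * of_real (cos (real n * x))) = of_real (cos_coeff ?F1 n) + \<i> * of_real (cos_coeff ?F2 n)" for n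
    by (subst split) (auto simp: cos_coeff_def intro!: continuous_intros F)
  have cG: "?I (\<lambda>x. G x * of_real (cos (real n * x))) = of_real (cos_coeff ?G1 n) + \<i> * of_real (cos_coeff ?G2 n)" for n
    by (subst split) (auto simp: cos_coeff_def intro!: continuous_intros G)
  have "(\<lambda>n. complex_of_real (cos_weight n * cos_coeff ?F1 n * cos_coeff ?G1 n - cos_weight n * cos_coeff ?F2 n * cos_coeff ?G2 n)
       + \<i> * of_real (cos_weight n * cos_coeff ?F1 n * cos_coeff ?G2 n + cos_weight n * cos_coeff ?F2 n * cos_coeff ?G1 n)) sums
     (of_real (?I (\<lambda>x. ?F1 x * ?G1 x) - ?I (\<lambda>x. ?F2 x * ?G2 x)) + \<i> * of_real (?I (\<lambda>x. ?F1 x * ?G2 x) + ?I (\<lambda>x. ?F2 x * ?G1 x)))"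
    by (intro sums_add sums_diff sums_mult sums_of_real cosine_Parseval_real c)
  moreover have "complex_of_real (?I (\<lambda>x. ?F1 x * ?G1 x) - ?I (\<lambda>x. ?F2 x * ?G2 x)) + \<i> * of_real (?I (\<lambda>x. ?F1 x * ?G2 x) + ?I (\<lambda>x. ?F2 x * ?G1 x)) = ?I (\<lambda>x. F x * G x)"
  proof -
    have "?I (\<lambda>x. ?F1 x * ?G1 x - ?F2 x * ?G2 x) = ?I (\<lambda>x. ?F1 x * ?G1 x) - ?I (\<lambda>x. ?F2 x * ?G2 x)"
      by (intro Henstock_Kurzweil_Integration.integral_diff integrable_continuous_real continuous_intros c)
    moreover have "?I (\<lambda>x. ?F1 x * ?G2 x + ?F2 x * ?G1 x) = ?I (\<lambda>x. ?F1 x * ?G2 x) + ?I (\<lambda>x. ?F2 x * ?G1 x)"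
      by (intro Henstock_Kurzweil_Integration.integral_add integrable_continuous_real continuous_intros c)
    ultimately show ?thesis
      by (subst split) (auto intro!: continuous_intros F G)
  qed
  moreover have "of_real (cos_weight n) * (of_real (cos_coeff ?F1 n) + \<i> * of_real (cos_coeff ?F2 n)) * (of_real (cos_coeff ?G1 n) + \<i> * of_real (cos_coeff ?G2 n)) =
     complex_of_real (cos_weight n * cos_coeff ?F1 n * cos_coeff ?G1 n - cos_weight n * cos_coeff ?F2 n * cos_coeff ?G2 n)
       + \<i> * of_real (cos_weight n * cos_coeff ?F1 n * cos_coeff ?G2 n + cos_weight n * cos_coeff ?F2 n * cos_coeff ?G1 n)" for n
    by (simp add: complex_eq_iff algebra_simps)
  ultimately show ?thesis unfolding cF cG by simp
qed

section \<open>The expansion\<close>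

lemma set_lebesgue_integral_eq_integral_continuous:
  fixes f :: "real \<Rightarrow> complex"
  assumes "continuous_on {a..b} f"
  shows "(LINT u:{a..b}|lborel. f u) = integral {a..b} f"
  by (rule set_borel_integral_eq_integral(2))
     (auto simp: set_integrable_def intro!: borel_integrable_compact assms)

lemma integral_symmetric_real:
  fixes g :: "real \<Rightarrow> complex"
  assumes "b \<ge> 0" and g: "continuous_on {-b..b} g"
  shows "integral {-b..b} g = integral {0..b} (\<lambda>u. g u + g (- u))"
proof -
  have i: "g integrable_on {-b..b}" by (rule integrable_continuous_real[OF g])
  have c1: "continuous_on {0..b} g" by (rule continuous_on_subset[OF g]) auto
  have c2: "continuous_on {0..b} (\<lambda>u. g (- u))"
    by (rule continuous_on_compose2[OF g]) (auto intro!: continuous_intros)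
  have "integral {-b..b} g = integral {-b..0} g + integral {0..b} g"
    using Henstock_Kurzweil_Integration.integral_combine[of "-b" 0 b g] i assms(1) by simp
  also have "integral {-b..0} g = integral {0..b} (\<lambda>u. g (- u))"
    using Henstock_Kurzweil_Integration.integral_reflect_real[of b 0 "\<lambda>u. g (- u)"] by simp
  finally show ?thesis
    using Henstock_Kurzweil_Integration.integral_add[OF integrable_continuous_real[OF c1] integrable_continuous_real[OF c2]]
    by (simp add: add.commute)
qed

lemma integral_by_parts_vanishing:
  fixes A A' B B' :: "real \<Rightarrow> complex"
  assumes ab: "a \<le> b"
    and A: "\<And>u. u \<in> {a..b} \<Longrightarrow> (A has_vector_derivative A' u) (at u within {a..b})"
    and B: "\<And>u. u \<in> {a..b} \<Longrightarrow> (B has_vector_derivative B' u) (at u within {a..b})"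
    and A': "continuous_on {a..b} A'" and B': "continuous_on {a..b} B'"
    and zero: "A a = 0" "A b = 0"
  shows "integral {a..b} (\<lambda>u. A u * B' u) = - integral {a..b} (\<lambda>u. A' u * B u)"
proof -
  have cA: "continuous_on {a..b} A" and cB: "continuous_on {a..b} B"
    by (rule continuous_on_vector_derivative, erule A, rule continuous_on_vector_derivative, erule B)
  have "((\<lambda>u. A u * B' u + A' u * B u) has_integral (A b * B b - A a * B a)) {a..b}"
    by (rule fundamental_theorem_of_calculus[OF ab]) (intro has_vector_derivative_mult A B)
  then have "integral {a..b} (\<lambda>u. A u * B' u + A' u * B u) = 0" using zero by (simp add: integral_unique)
  moreover have "integral {a..b} (\<lambda>u. A u * B' u + A' u * B u) = integral {a..b} (\<lambda>u. A u * B' u) + integral {a..b} (\<lambda>u. A' u * B u)"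
    by (intro Henstock_Kurzweil_Integration.integral_add integrable_continuous_real continuous_intros cA cB A' B')
  ultimately show ?thesis by (simp add: eq_neg_iff_add_eq_0)
qed

lemma continuous_on_cpow_cosh:
  assumes "x > 1"
  shows "continuous_on S (\<lambda>u. cpow (x + cosh u) z)"
proof -
  have p: "x + cosh u > 0" for u using assms cosh_real_ge_1[of u] by linarith
  show ?thesis unfolding cpow_def by (intro continuous_intros) (use p in \<open>auto simp: less_imp_neq[symmetric]\<close>)
qed

lemma cpow_cosh_derivative:
  assumes "x > 1"
  shows "((\<lambda>u. cpow (x + cosh u) z) has_vector_derivative z * of_real (sinh u) * cpow (x + cosh u) (z - 1)) (at u within S)"
proof -
  have p: "x + cosh u > 0" using assms cosh_real_ge_1[of u] by linarith
  have "((\<lambda>u. ln (x + cosh u)) has_real_derivative sinh u / (x + cosh u)) (at u within S)"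
    using p by (auto intro!: derivative_eq_intros)
  then have "((\<lambda>u. z * complex_of_real (ln (x + cosh u))) has_vector_derivative z * of_real (sinh u / (x + cosh u))) (at u within S)"
    by (intro has_vector_derivative_mult_right has_vector_derivative_of_real)
       (simp add: has_real_derivative_iff_has_vector_derivative)
  then have "((exp \<circ> (\<lambda>u. z * complex_of_real (ln (x + cosh u)))) has_vector_derivative
      (z * of_real (sinh u / (x + cosh u))) * exp (z * complex_of_real (ln (x + cosh u)))) (at u within S)"
    by (rule field_vector_diff_chain_within) (rule has_field_derivative_at_within[OF DERIV_exp])
  moreover have "cpow (x + cosh u) (z - 1) = cpow (x + cosh u) z / of_real (x + cosh u)"
    using p by (simp add: cpow_def left_diff_distrib exp_diff exp_of_real)
  ultimately show ?thesis by (simp add: cpow_def o_def)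
qed

theorem theorem2:
  fixes mu :: complex and \<psi> :: "real \<Rightarrow> complex" and f :: "real \<Rightarrow> complex"
  assumes mu: "Re mu < 1/2"
    and per: "\<forall>u. \<psi> (u + 2 * pi) = \<psi> u"
    and C1: "\<exists>\<psi>'. (\<forall>u\<in>{-pi..pi}. (\<psi> has_vector_derivative \<psi>' u) (at u within {-pi..pi}))
                  \<and> continuous_on {-pi..pi} \<psi>'"
    and f_def: "\<forall>t>1. f t = complex_of_real (t^2 - 1) powr (- mu / 2) *
        integral {-pi..pi} (\<lambda>u. \<psi> u * complex_of_real (sinh u) /
                               complex_of_real (t + cosh u) powr (3/2 - mu))"
    and x: "x > (1::real)"
  shows "(\<lambda>k. let n = real (Suc k); nu = \<i> * complex_of_real n - 1/2 in
            1 / complex_of_real pi * complex_of_real (n * sinh (pi * n)) *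
            Gamma (1/2 + \<i> * complex_of_real n - mu) * Gamma (1/2 - \<i> * complex_of_real n - mu) *
            legendreP_inc mu nu x pi *
            integral {1<..} (\<lambda>t. legendreP mu nu t * f t))
         sums f x"
proof -
  obtain \<psi>' where d\<psi>: "\<And>u. u \<in> {-pi..pi} \<Longrightarrow> (\<psi> has_vector_derivative \<psi>' u) (at u within {-pi..pi})"
    and c\<psi>': "continuous_on {-pi..pi} \<psi>'" using C1 by blast
  have c\<psi>: "continuous_on {-pi..pi} \<psi>"
    by (rule continuous_on_vector_derivative[OF d\<psi>])
  \<comment> \<open>As sinh is odd and cosh even, folding [-pi, pi] onto [0, pi] leaves exactly this
    difference.\<close>
  define A where "A = (\<lambda>u. \<psi> u - \<psi> (- u))"
  define A' where "A' = (\<lambda>u. \<psi>' u + \<psi>' (- u))"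
  have dA: "(A has_vector_derivative A' u) (at u within {0..pi})" if u: "u \<in> {0..pi}" for u
  proof -
    have 1: "(\<psi> has_vector_derivative \<psi>' u) (at u within {0..pi})"
      by (rule has_vector_derivative_within_subset[OF d\<psi>]) (use u in auto)
    have m: "(uminus has_vector_derivative -1) (at u within {0..pi})"
      by (auto intro!: derivative_eq_intros)
    have "(\<psi> has_vector_derivative \<psi>' (- u)) (at (- u) within uminus ` {0..pi})"
      by (rule has_vector_derivative_within_subset[OF d\<psi>]) (use u in auto)
    from vector_diff_chain_within[OF m this]
    have 2: "((\<lambda>u. \<psi> (- u)) has_vector_derivative - \<psi>' (- u)) (at u within {0..pi})"
      by (simp add: o_def)
    show ?thesis unfolding A_def A'_def using has_vector_derivative_diff[OF 1 2] by simp
  qed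
  have cA': "continuous_on {0..pi} A'"
    unfolding A'_def
    by (intro continuous_on_add continuous_on_subset[OF c\<psi>'] continuous_on_compose2[OF c\<psi>', of _ uminus])
       (auto intro!: continuous_intros)
  have cA: "continuous_on {0..pi} A"
    by (rule continuous_on_vector_derivative[OF dA])
  \<comment> \<open>Periodicity at u = -pi gives A pi = 0. With both endpoint values zero, neither
    integration by parts below has boundary terms.\<close>
  have A0: "A 0 = 0" "A pi = 0"
    using per[rule_format, of "- pi"] by (auto simp: A_def)
  have ch: "t + cosh u > 0" if "t > 1" for t u :: real using that cosh_real_ge_1[of u] by linarith
  have sq: "t\<^sup>2 - 1 > 0" if "t > 1" for t :: real using that by (simp add: one_less_power)
  have cs: "continuous_on S (\<lambda>u. complex_of_real (sinh u) * cpow (t + cosh u) z)" if "t > 1" for t z S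
    by (intro continuous_intros continuous_on_cpow_cosh that)
  have fI: "f t = cpow (t\<^sup>2 - 1) (- mu / 2) *
      integral {0..pi} (\<lambda>u. A u * of_real (sinh u) * cpow (t + cosh u) (mu - 3/2))" if t: "t > 1" for t
  proof -
    let ?g = "\<lambda>u. \<psi> u * complex_of_real (sinh u) * cpow (t + cosh u) (mu - 3/2)"
    have pw: "z / complex_of_real (t + cosh u) powr (3/2 - mu) = z * cpow (t + cosh u) (mu - 3/2)" for z u
      by (simp only: cpow_eq_powr[OF ch[OF t]] divide_inverse cpow_minus[symmetric] minus_diff_eq)
    have "integral {-pi..pi} ?g = integral {0..pi} (\<lambda>u. ?g u + ?g (- u))"
      by (rule integral_symmetric_real) (use continuous_on_mult[OF c\<psi> cs[OF t]] in \<open>simp_all add: mult.assoc\<close>)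
    also have "(\<lambda>u. ?g u + ?g (- u)) = (\<lambda>u. A u * of_real (sinh u) * cpow (t + cosh u) (mu - 3/2))"
      by (simp add: A_def fun_eq_iff algebra_simps)
    finally show ?thesis
      using f_def t cpow_eq_powr[OF sq[OF t]] by (simp only: pw)
  qed
  have fL: "f t = cpow (t\<^sup>2 - 1) (- mu / 2) *
      (LINT u:{0..pi}|lborel. A u * of_real (sinh u) * cpow (t + cosh u) (mu - 3/2))" if t: "t > 1" for t
    unfolding fI[OF t] using continuous_on_mult[OF cA cs[OF t]]
    by (subst set_lebesgue_integral_eq_integral_continuous) (simp_all add: mult.assoc)
  let ?X = "cpow (x\<^sup>2 - 1) (- mu / 2)"
  let ?G = "\<lambda>u. cpow (x + cosh u) (mu - 1/2)"
  have half: "1/2 - mu \<noteq> 0" using mu by (auto simp: complex_eq_iff)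
  have cG: "continuous_on {0..pi} ?G" by (rule continuous_on_cpow_cosh[OF x])
  \<comment> \<open>The kernel sinh u (x + cosh u)^(mu - 3/2) is, up to the factor mu - 1/2, the
    derivative of (x + cosh u)^(mu - 1/2), so the derivative can be moved to A.\<close>
  have fx: "f x = ?X / (1/2 - mu) * integral {0..pi} (\<lambda>u. A' u * ?G u)"
  proof -
    let ?B' = "\<lambda>u. (mu - 1/2) * of_real (sinh u) * cpow (x + cosh u) (mu - 1/2 - 1)"
    have e: "mu - 1/2 - 1 = mu - 3/2" by (simp add: complex_eq_iff)
    have "integral {0..pi} (\<lambda>u. A u * ?B' u) = - integral {0..pi} (\<lambda>u. A' u * ?G u)"
      by (rule integral_by_parts_vanishing[OF _ dA cpow_cosh_derivative[OF x] cA' _ A0])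
         (auto intro!: continuous_intros continuous_on_cpow_cosh x)
    also have "integral {0..pi} (\<lambda>u. A u * ?B' u) = (mu - 1/2) * integral {0..pi} (\<lambda>u. A u * of_real (sinh u) * cpow (x + cosh u) (mu - 3/2))"
      unfolding e by (subst integral_mult_right[symmetric]) (simp add: mult_ac)
    finally have "(1/2 - mu) * integral {0..pi} (\<lambda>u. A u * of_real (sinh u) * cpow (x + cosh u) (mu - 3/2)) = integral {0..pi} (\<lambda>u. A' u * ?G u)"
      by (simp add: algebra_simps)
    moreover have "X * I = X / h * J" if "h * I = J" "h \<noteq> 0" for X I J h :: complex
      using that by auto
    ultimately show ?thesis unfolding fI[OF x] using half by blast
  qed
  let ?a = "\<lambda>k. integral {0..pi} (\<lambda>u. A' u * of_real (cos (real k * u)))"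
  let ?b = "\<lambda>k. integral {0..pi} (\<lambda>u. ?G u * of_real (cos (real k * u)))"
  have a0: "?a 0 = 0"
  proof -
    have "(A' has_integral (A pi - A 0)) {0..pi}"
      by (rule fundamental_theorem_of_calculus) (use dA in auto)
    then show ?thesis using A0 by (simp add: integral_unique)
  qed
  have "(\<lambda>k. of_real (cos_weight k) * ?a k * ?b k) sums integral {0..pi} (\<lambda>u. A' u * ?G u)"
    by (rule cosine_Parseval_complex[OF cA' cG])
  \<comment> \<open>Dropping the vanishing term at k = 0 aligns the index with the series of the
    claim, which begins at n = 1, and leaves only the weight 2/pi.\<close>
  then have "(\<lambda>k. of_real (cos_weight (Suc k)) * ?a (Suc k) * ?b (Suc k)) sums integral {0..pi} (\<lambda>u. A' u * ?G u)"
    by (subst sums_Suc_iff) (simp only: a0, simp)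
  then have S: "(\<lambda>k. ?X / (1/2 - mu) * (of_real (2 / pi) * ?a (Suc k) * ?b (Suc k))) sums f x"
    unfolding fx by (intro sums_mult) (simp add: cos_weight_def)
  \<comment> \<open>Integration by parts against -cos(nu)/n. The resulting 1/n is what the factor n
    in the series compensates.\<close>
  have sin_int: "(LINT u:{0..pi}|lborel. A u * of_real (sin (n * u))) = ?a k / of_real n"
    if n: "n = real k" "n > 0" for n k
  proof -
    have c: "continuous_on {0..pi} (\<lambda>u. A u * of_real (sin (n * u)))" by (intro continuous_intros cA)
    have D: "((\<lambda>u. - complex_of_real (cos (n * u)) / of_real n) has_vector_derivative of_real (sin (n * u))) (at u within {0..pi})" for u
    proof -
      have "((\<lambda>u. - cos (n * u) / n) has_real_derivative sin (n * u)) (at u within {0..pi})"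
        using n(2) by (auto intro!: derivative_eq_intros)
      then have "((\<lambda>u. complex_of_real (- cos (n * u) / n)) has_vector_derivative of_real (sin (n * u))) (at u within {0..pi})"
        by (intro has_vector_derivative_of_real) (simp add: has_real_derivative_iff_has_vector_derivative)
      then show ?thesis by simp
    qed
    have "integral {0..pi} (\<lambda>u. A u * of_real (sin (n * u))) = - integral {0..pi} (\<lambda>u. A' u * (- complex_of_real (cos (n * u)) / of_real n))"
      by (rule integral_by_parts_vanishing[OF _ dA D cA' _ A0]) (auto intro!: continuous_intros)
    also have "\<dots> = integral {0..pi} (\<lambda>u. A' u * complex_of_real (cos (n * u))) / of_real n"
      by (simp add: times_divide_eq_right)
    finally have "(LINT u:{0..pi}|lborel. A u * of_real (sin (n * u))) =
        integral {0..pi} (\<lambda>u. A' u * complex_of_real (cos (n * u))) / of_real n"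
      unfolding set_lebesgue_integral_eq_integral_continuous[OF c] .
    then show ?thesis unfolding n(1) .
  qed
  \<comment> \<open>Every normalising factor finds its partner: n against \<open>sin_int\<close>,
    sinh(pi n) against the transform, the two shifted Gamma values against the denominator of
    \<open>legendreP_inc\<close>, and Gamma(1/2 - mu) between \<open>legendreP_inc\<close> and the
    transform. The square roots multiply to 2, which with 1/pi gives the cosine weight.\<close>
  have summand: "(let n = real (Suc k); nu = \<i> * complex_of_real n - 1/2 in
            1 / complex_of_real pi * complex_of_real (n * sinh (pi * n)) *
            Gamma (1/2 + \<i> * complex_of_real n - mu) * Gamma (1/2 - \<i> * complex_of_real n - mu) *
            legendreP_inc mu nu x pi *
            integral {1<..} (\<lambda>t. legendreP mu nu t * f t)) =
        ?X / (1/2 - mu) * (of_real (2 / pi) * ?a (Suc k) * ?b (Suc k))" for k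
  proof -
    define n where "n = real (Suc k)"
    have n: "n > 0" by (simp add: n_def)
    define nu where "nu = \<i> * complex_of_real n - 1/2"
    let ?Gp = "Gamma (1/2 + \<i> * complex_of_real n - mu)" and ?Gm = "Gamma (1/2 - \<i> * complex_of_real n - mu)"
    let ?Gh = "Gamma (1/2 - mu)"
    have np: "z \<notin> \<int>\<^sub>\<le>\<^sub>0" if "Re z > 0" for z using that by (auto elim!: nonpos_Ints_cases)
    have nz: "?Gp \<noteq> 0" "?Gm \<noteq> 0" "?Gh \<noteq> 0"
      unfolding Gamma_eq_zero_iff by (rule np, use mu in simp)+
    have G3: "Gamma (3/2 - mu) = (1/2 - mu) * ?Gh"
    proof -
      have "3/2 - mu = 1/2 - mu + 1" by (simp add: complex_eq_iff)
      then show ?thesis using Gamma_plus1[of "1/2 - mu"] np[of "1/2 - mu"] mu by simp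
    qed
    have J: "integral {1<..} (\<lambda>t. legendreP mu nu t * f t) =
        of_real (sqrt (2 * pi) / sinh (pi * n)) / ((1/2 - mu) * ?Gh) * (?a (Suc k) / of_real n)"
      using mehler_fock_transform[OF mu n cA fL] unfolding nu_def G3 sin_int[OF n_def n] .
    have inc: "legendreP_inc mu nu x pi = of_real (sqrt (2 / pi)) * ?Gh * ?X / (?Gp * ?Gm) * ?b (Suc k)"
    proof -
      have "cosh (complex_of_real t * (nu + 1/2)) / complex_of_real (cosh t + x) powr (1/2 - mu) =
          ?G t * of_real (cos (real (Suc k) * t))" for t
      proof -
        have "cosh (complex_of_real t * (nu + 1/2)) = cos (- of_real (n * t))"
          unfolding cosh_conv_cos by (rule arg_cong[where f=cos]) (simp add: nu_def algebra_simps)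
        also have "\<dots> = of_real (cos (n * t))" by (simp only: cos_minus cos_of_real)
        finally have 1: "cosh (complex_of_real t * (nu + 1/2)) = of_real (cos (n * t))" .
        have 2: "complex_of_real (cosh t + x) powr (1/2 - mu) = inverse (?G t)"
          by (simp only: add.commute[of "cosh t"] cpow_eq_powr[OF ch[OF x]] cpow_minus[symmetric] minus_diff_eq)
        show ?thesis unfolding 1 2 n_def by (simp only: divide_inverse inverse_inverse_eq mult.commute)
      qed
      moreover have "1 + nu - mu = 1/2 + \<i> * complex_of_real n - mu" "- nu - mu = 1/2 - \<i> * complex_of_real n - mu"
        by (auto simp: nu_def complex_eq_iff)
      ultimately show ?thesis
        unfolding legendreP_inc_def cpow_eq_powr[OF sq[OF x]] by simp
    qed
    have sh: "complex_of_real (sinh (pi * n)) \<noteq> 0" using n by simp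
    have sq2: "complex_of_real (sqrt (2 / pi)) * of_real (sqrt (2 * pi)) = 2"
    proof -
      have "sqrt (2 / pi) * sqrt (2 * pi) = 2" by (simp flip: real_sqrt_mult)
      then show ?thesis by (metis of_real_mult of_real_numeral)
    qed
    have "1 / complex_of_real pi * complex_of_real (n * sinh (pi * n)) * ?Gp * ?Gm * legendreP_inc mu nu x pi *
        integral {1<..} (\<lambda>t. legendreP mu nu t * f t) =
        ?X / (1/2 - mu) * ((complex_of_real (sqrt (2 / pi)) * of_real (sqrt (2 * pi))) / of_real pi * ?a (Suc k) * ?b (Suc k))"
      unfolding J inc of_real_mult of_real_divide using nz sh n half by (simp add: divide_simps)
    also have "\<dots> = ?X / (1/2 - mu) * (of_real (2 / pi) * ?a (Suc k) * ?b (Suc k))"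
      unfolding sq2 by simp
    finally show ?thesis by (simp only: Let_def n_def nu_def)
  qed
  show ?thesis unfolding summand by (rule S)
qed

end
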